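(* Let $Q\subset\mathbb P^3$ be a smooth quadric surface and let $\Pi_1,\Pi_2\subset\mathbb P^3$ be two planes, all defined over a number field, such that the intersection $Q\cap\Pi_1\cap\Pi_2$ is proper, i.e. it consists of two points. Let $X^o:=\mathbb P^3\setminus(Q\cup\Pi_1\cup\Pi_2)$. Then the integral points on $X^o$ are potentially dense.
   Context: Let $X\subset\mathbb P^n$ be a projective variety over a number field $\mathbb K$, let $D\subset X$ be a proper closed algebraic subset and let $X^o=X\setminus D$. For a finite set $S$ of places of $\mathbb K$ containing the archimedean ones, a point $P\in X^o(\mathbb K)$ is $S$-integral with respect to $D$ if for no place $\nu\notin S$ does $P$ reduce modulo $\nu$ to a point of $D$. The integral points of $X^o$ are potentially dense if, after replacing $\mathbb K$ by a suitable finite extension and enlarging the finite set $S$ suitably, the set of $S$-integral points of $X^o$ is Zariski-dense. *)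

theory Defs
  imports "HOL-Analysis.Analysis" "HOL-Library.Poly_Mapping" "HOL-Library.FuncSet"
begin

section \<open>Projective space\<close>

text \<open>All number fields are taken inside the complex numbers, and varieties are identified with
  their sets of complex points. The finite type \<open>'n\<close> indexes the homogeneous coordinates, so
  \<open>'n proj\<close> is projective space of dimension \<open>CARD('n) - 1\<close>. A point is the set of its
  homogeneous coordinate vectors.\<close>

typedef (overloaded) 'n::finite proj =
    "{{c *s x |c. c \<noteq> 0} |x :: complex ^ 'n. x \<noteq> 0}"
  morphisms hcoords Abs_proj
proof -
  have "(1 :: complex ^ 'n) \<noteq> 0"
    by simp
  then show ?thesis
    by blast
qed

type_synonym 'n polynomial = "('n \<Rightarrow>\<^sub>0 nat) \<Rightarrow>\<^sub>0 complex"

definition eval_poly :: "'n::finite polynomial \<Rightarrow> complex ^ 'n \<Rightarrow> complex" where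
  "eval_poly f x = (\<Sum>m\<in>Poly_Mapping.keys f.
     Poly_Mapping.lookup f m * (\<Prod>i\<in>UNIV. (x $ i) ^ Poly_Mapping.lookup m i))"

definition partial_deriv :: "'n::finite \<Rightarrow> 'n polynomial \<Rightarrow> 'n polynomial" where
  "partial_deriv i f = (\<Sum>m\<in>Poly_Mapping.keys f.
     Poly_Mapping.single (m - Poly_Mapping.single i 1)
       (of_nat (Poly_Mapping.lookup m i) * Poly_Mapping.lookup f m))"

text \<open>Homogeneous of degree \<open>d\<close> with coefficients in \<open>R\<close>; the zero polynomial is a form of every
  degree.\<close>

definition is_form :: "complex set \<Rightarrow> nat \<Rightarrow> 'n::finite polynomial \<Rightarrow> bool" where
  "is_form R d f \<longleftrightarrow> (\<forall>m\<in>Poly_Mapping.keys f.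
     (\<Sum>i\<in>UNIV. Poly_Mapping.lookup m i) = d \<and> Poly_Mapping.lookup f m \<in> R)"

definition zero_locus :: "'n::finite polynomial set \<Rightarrow> 'n proj set" where
  "zero_locus F = {P. \<forall>f\<in>F. \<forall>x\<in>hcoords P. eval_poly f x = 0}"

definition zariski_closed :: "'n::finite proj set \<Rightarrow> bool" where
  "zariski_closed Z \<longleftrightarrow> (\<exists>F. (\<forall>f\<in>F. \<exists>d. is_form UNIV d f) \<and> Z = zero_locus F)"

definition zariski_dense_in :: "'n::finite proj set \<Rightarrow> 'n proj set \<Rightarrow> bool" where
  "zariski_dense_in A X \<longleftrightarrow> A \<subseteq> X \<and> (\<forall>Z. zariski_closed Z \<and> A \<subseteq> Z \<longrightarrow> X \<subseteq> Z)"

definition rational_points :: "complex set \<Rightarrow> 'n::finite proj set" where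
  "rational_points K = {P. \<exists>x\<in>hcoords P. \<forall>i. x $ i \<in> K}"

definition hyperplane :: "complex set \<Rightarrow> 'n::finite proj set \<Rightarrow> bool" where
  "hyperplane K H \<longleftrightarrow> (\<exists>l. l \<noteq> 0 \<and> is_form K 1 l \<and> H = zero_locus {l})"

definition smooth_quadric :: "complex set \<Rightarrow> 'n::finite proj set \<Rightarrow> bool" where
  "smooth_quadric K Q \<longleftrightarrow> (\<exists>q. q \<noteq> 0 \<and> is_form K 2 q \<and> Q = zero_locus {q} \<and>
     (\<forall>P\<in>Q. \<forall>x\<in>hcoords P. \<exists>i. eval_poly (partial_deriv i q) x \<noteq> 0))"


section \<open>Number fields and their places\<close>

definition number_field :: "complex set \<Rightarrow> bool" where
  "number_field K \<longleftrightarrow>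
     1 \<in> K \<and> (\<forall>x\<in>K. \<forall>y\<in>K. x - y \<in> K \<and> x * y \<in> K) \<and> (\<forall>x\<in>K. inverse x \<in> K) \<and>
     (\<exists>B. finite B \<and> K = {\<Sum>b\<in>B. of_rat (c b) * b |c. True})"

text \<open>Absolute values are functions on \<open>K\<close>; \<open>extensional\<close> makes them unique as HOL functions, so
  that the set of places can be finite.\<close>

definition nontrivial_abs_values :: "complex set \<Rightarrow> (complex \<Rightarrow> real) set" where
  "nontrivial_abs_values K = {v \<in> extensional K.
     (\<forall>x\<in>K. v x \<ge> 0 \<and> (v x = 0 \<longleftrightarrow> x = 0)) \<and>
     (\<forall>x\<in>K. \<forall>y\<in>K. v (x * y) = v x * v y \<and> v (x + y) \<le> v x + v y) \<and>
     (\<exists>x\<in>K. x \<noteq> 0 \<and> v x \<noteq> 1)}"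

definition abs_value_equiv :: "complex set \<Rightarrow> ((complex \<Rightarrow> real) \<times> (complex \<Rightarrow> real)) set" where
  "abs_value_equiv K = {(v, w). v \<in> nontrivial_abs_values K \<and> w \<in> nontrivial_abs_values K \<and>
     (\<exists>s>0. \<forall>x\<in>K. w x = v x powr s)}"

definition places :: "complex set \<Rightarrow> (complex \<Rightarrow> real) set set" where
  "places K = nontrivial_abs_values K // abs_value_equiv K"

definition archimedean :: "complex set \<Rightarrow> (complex \<Rightarrow> real) set \<Rightarrow> bool" where
  "archimedean K \<nu> \<longleftrightarrow> (\<exists>v\<in>\<nu>. \<exists>x\<in>K. \<exists>y\<in>K. v (x + y) > max (v x) (v y))"

definition valuation_ring :: "complex set \<Rightarrow> (complex \<Rightarrow> real) set \<Rightarrow> complex set" where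
  "valuation_ring K \<nu> = {x \<in> K. \<exists>v\<in>\<nu>. v x \<le> 1}"

definition valuation_ideal :: "complex set \<Rightarrow> (complex \<Rightarrow> real) set \<Rightarrow> complex set" where
  "valuation_ideal K \<nu> = {x \<in> K. \<exists>v\<in>\<nu>. v x < 1}"


section \<open>Integral points\<close>

text \<open>The reduction of \<open>D\<close> modulo a nonarchimedean place \<open>\<nu>\<close> is the special fibre of the closure of
  \<open>D\<close> in projective space over the valuation ring: it is cut out by the reductions of all forms
  with coefficients in the valuation ring that vanish on \<open>D\<close>. The point \<open>P\<close> is reduced by means
  of coordinates in the valuation ring that are not all in the maximal ideal.\<close>

definition reduces_into ::
    "complex set \<Rightarrow> (complex \<Rightarrow> real) set \<Rightarrow> 'n::finite proj \<Rightarrow> 'n proj set \<Rightarrow> bool" where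
  "reduces_into K \<nu> P D \<longleftrightarrow> (\<exists>x\<in>hcoords P.
     (\<forall>i. x $ i \<in> valuation_ring K \<nu>) \<and> (\<exists>i. x $ i \<notin> valuation_ideal K \<nu>) \<and>
     (\<forall>d f. is_form (valuation_ring K \<nu>) d f \<and> D \<subseteq> zero_locus {f} \<longrightarrow>
        eval_poly f x \<in> valuation_ideal K \<nu>))"

definition integral_points ::
    "complex set \<Rightarrow> (complex \<Rightarrow> real) set set \<Rightarrow> 'n::finite proj set \<Rightarrow> 'n proj set \<Rightarrow> 'n proj set" where
  "integral_points K S X D =
     {P \<in> rational_points K \<inter> (X - D). \<forall>\<nu>\<in>places K - S. \<not> reduces_into K \<nu> P D}"

text \<open>Since number fields are finite over the rationals, a finite extension of \<open>K\<close> is just a larger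
  number field. The set of integral points grows with \<open>S\<close>, so asking for some \<open>S\<close> is the same
  as asking for an enlargement of a given finite set of places.\<close>

definition potentially_dense ::
    "complex set \<Rightarrow> 'n::finite proj set \<Rightarrow> 'n proj set \<Rightarrow> bool" where
  "potentially_dense K X D \<longleftrightarrow> (\<exists>L S. number_field L \<and> K \<subseteq> L \<and>
     finite S \<and> S \<subseteq> places L \<and> {\<nu> \<in> places L. archimedean L \<nu>} \<subseteq> S \<and>
     zariski_dense_in (integral_points L S X D) (X - D))"

end

theory Submission
  imports Defs "HOL-Computational_Algebra.Primes" "HOL-Computational_Algebra.Polynomial"
begin

text \<open>Over a finite extension \<open>L\<close> of \<open>K\<close> containing the coordinates of the two points of
  \<open>Q \<inter> \<Pi>1 \<inter> \<Pi>2\<close> there are linear coordinates in which the planes are \<open>x\<^sub>0 = 0\<close> and \<open>x\<^sub>1 = 0\<close> and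
  the quadric is \<open>\<beta> x\<^sub>2 x\<^sub>3 + N (x\<^sub>0, x\<^sub>1) = 0\<close> with \<open>\<beta> \<noteq> 0\<close>. For arbitrary units \<open>u\<close>, \<open>t\<close>, \<open>w\<close> the point
  \<open>(1 : u : t : (w - N (1, u)) / (\<beta> t))\<close> is integral, because the three forms take the unit
  values \<open>1\<close>, \<open>u\<close>, \<open>w\<close> there. If \<open>2\<close> is a unit, letting \<open>u\<close>, \<open>t\<close>, \<open>w\<close> run through the powers of \<open>2\<close>
  gives a Zariski-dense set.

  The set \<open>S\<close> consists of the archimedean places and of those at which one of finitely many
  numbers is not integral. It is finite because places inducing the same ordering of absolute
  values on the rationals are finite in number: by weak approximation, \<open>n\<close> inequivalent ones yield
  \<open>n\<close> elements of \<open>L\<close> that are linearly independent over the rationals.\<close>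


section \<open>Absolute values on a number field\<close>

text \<open>The last coordinate enters the equation of the quadric linearly, with coefficient
  \<open>\<beta> * t\<close>, so prescribing the value \<open>w\<close> costs only a division by a
  unit, and \<open>u\<close>, \<open>t\<close>, \<open>w\<close> can be chosen independently. The
  two intersection points provide this linearity: both are isotropic, so on the line joining them
  the quadric has no square terms, and the mixed term is nonzero because otherwise the whole line
  would lie in \<open>Q\<close>. They are roots of one binary quadratic form, so two successive
  quadratic extensions suffice. Density needs only infinitely many values of each parameter, so
  inverting 2 replaces the unit theorem. Finiteness of \<open>S\<close> is obtained without ideal
  theory: the possible orders on the rationals are determined by Ostrowski's argument and by p-adic
  valuations, and only the number of places inducing a given order has to be bounded. To exclude
  reduction into the boundary, a single form is exhibited, the product of the three equations.
  Integrality is tested in the original coordinates, so the frame must have integral entries but not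
  an integral inverse.\<close>

global_interpretation rat_vs: vector_space "\<lambda>(q::rat) (x::complex). of_rat q * x"
  by unfold_locales (simp_all add: algebra_simps of_rat_add of_rat_mult)

lemma number_field_iff_span:
  "number_field K \<longleftrightarrow> 1 \<in> K \<and> (\<forall>x\<in>K. \<forall>y\<in>K. x - y \<in> K \<and> x * y \<in> K) \<and>
     (\<forall>x\<in>K. inverse x \<in> K) \<and> (\<exists>B. finite B \<and> K = rat_vs.span B)"
proof -
  have "{\<Sum>b\<in>B. of_rat (c b) * b |c. True} = rat_vs.span B" if "finite B" for B :: "complex set"
    using rat_vs.span_finite[OF that] by auto
  then have "(\<exists>B. finite B \<and> K = {\<Sum>b\<in>B. of_rat (c b) * b |c. True}) \<longleftrightarrow>
      (\<exists>B. finite B \<and> K = rat_vs.span B)"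
    by auto
  then show ?thesis
    unfolding number_field_def by simp
qed

locale num_field =
  fixes K :: "complex set"
  assumes num_field: "number_field K"
begin

lemma one_mem [simp]: "1 \<in> K"
  and diff_mem [simp]: "x \<in> K \<Longrightarrow> y \<in> K \<Longrightarrow> x - y \<in> K"
  and mult_mem [simp]: "x \<in> K \<Longrightarrow> y \<in> K \<Longrightarrow> x * y \<in> K"
  and inverse_mem [simp]: "x \<in> K \<Longrightarrow> inverse x \<in> K"
  using num_field by (auto simp: number_field_def)

lemma zero_mem [simp]: "0 \<in> K"
  using diff_mem[of 1 1] by simp

lemma uminus_mem [simp]: "x \<in> K \<Longrightarrow> - x \<in> K"
  using diff_mem[of 0 x] by simp

lemma add_mem [simp]: "x \<in> K \<Longrightarrow> y \<in> K \<Longrightarrow> x + y \<in> K"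
  using diff_mem[of x "- y"] by simp

lemma divide_mem [simp]: "x \<in> K \<Longrightarrow> y \<in> K \<Longrightarrow> x / y \<in> K"
  by (simp add: divide_inverse)

lemma power_mem [simp]: "x \<in> K \<Longrightarrow> x ^ n \<in> K"
  by (induction n) auto

lemma power_int_mem [simp]: "x \<in> K \<Longrightarrow> x powi n \<in> K"
  by (simp add: power_int_def)

lemma of_nat_mem [simp]: "of_nat n \<in> K"
  by (induction n) auto

lemma numeral_mem [simp]: "numeral n \<in> K"
  using of_nat_mem[of "numeral n"] by simp

lemma of_int_mem [simp]: "of_int n \<in> K"
  by (cases n) auto

lemma of_rat_mem [simp]: "of_rat r \<in> K"
  by (cases r) (auto simp: of_rat_rat)

lemma sum_mem: "(\<And>i. i \<in> A \<Longrightarrow> f i \<in> K) \<Longrightarrow> sum f A \<in> K"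
  by (induction A rule: infinite_finite_induct) auto

lemma prod_mem: "(\<And>i. i \<in> A \<Longrightarrow> f i \<in> K) \<Longrightarrow> prod f A \<in> K"
  by (induction A rule: infinite_finite_induct) auto

definition absval :: "(complex \<Rightarrow> real) \<Rightarrow> bool" where
  "absval v \<longleftrightarrow> v \<in> nontrivial_abs_values K"

context
  fixes v assumes v: "absval v"
begin

lemma av_nonneg [simp]: "x \<in> K \<Longrightarrow> v x \<ge> 0"
  and av_eq_0 [simp]: "x \<in> K \<Longrightarrow> v x = 0 \<longleftrightarrow> x = 0"
  and av_mult: "x \<in> K \<Longrightarrow> y \<in> K \<Longrightarrow> v (x * y) = v x * v y"
  and av_add: "x \<in> K \<Longrightarrow> y \<in> K \<Longrightarrow> v (x + y) \<le> v x + v y"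
  and av_nontriv: "\<exists>x\<in>K. x \<noteq> 0 \<and> v x \<noteq> 1"
  using v by (auto simp: absval_def nontrivial_abs_values_def)

lemma av_0 [simp]: "v 0 = 0"
  by simp

lemma av_pos [simp]: "x \<in> K \<Longrightarrow> v x > 0 \<longleftrightarrow> x \<noteq> 0"
  using av_nonneg[of x] av_eq_0[of x] by linarith

lemma av_1 [simp]: "v 1 = 1"
  using av_mult[of 1 1] av_eq_0[of 1] by simp

lemma av_minus [simp]: assumes "x \<in> K" shows "v (- x) = v x"
proof -
  have "v (-1) * v (-1) = 1"
    using av_mult[of "-1" "-1"] by simp
  moreover have "v (-1) \<ge> 0"
    using av_nonneg[of "-1"] by simp
  ultimately have "v (-1) = 1"
    using square_eq_1_iff[of "v (-1)"] by arith
  then show ?thesis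
    using av_mult[of "-1" x] assms by simp
qed

lemma av_power: "x \<in> K \<Longrightarrow> v (x ^ n) = v x ^ n"
  by (induction n) (auto simp: av_mult)

lemma av_inverse: assumes "x \<in> K" shows "v (inverse x) = inverse (v x)"
proof (cases "x = 0")
  case False
  then have "v x * v (inverse x) = 1"
    using av_mult[of x "inverse x"] assms by simp
  then show ?thesis
    by (simp add: inverse_unique)
qed auto

lemma av_divide: "x \<in> K \<Longrightarrow> y \<in> K \<Longrightarrow> v (x / y) = v x / v y"
  by (simp add: divide_inverse av_mult av_inverse)

lemma av_power_int: "x \<in> K \<Longrightarrow> v (x powi n) = v x powi n"
  by (simp add: power_int_def av_power av_inverse)

lemma av_sum: "(\<And>i. i \<in> A \<Longrightarrow> f i \<in> K) \<Longrightarrow> v (sum f A) \<le> (\<Sum>i\<in>A. v (f i))"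
proof (induction A rule: infinite_finite_induct)
  case (insert a A)
  then have "v (f a + sum f A) \<le> v (f a) + v (sum f A)"
    by (intro av_add sum_mem) auto
  with insert show ?case by simp
qed auto

lemma av_prod: "(\<And>i. i \<in> A \<Longrightarrow> f i \<in> K) \<Longrightarrow> v (prod f A) = (\<Prod>i\<in>A. v (f i))"
  by (induction A rule: infinite_finite_induct) (auto simp: av_mult prod_mem)

lemma av_gt_1: "\<exists>x\<in>K. v x > 1"
proof -
  obtain x where x: "x \<in> K" "x \<noteq> 0" "v x \<noteq> 1"
    using av_nontriv by auto
  show ?thesis
  proof (cases "v x > 1")
    case False
    then have "v (inverse x) > 1"
      using x by (simp add: av_inverse one_less_inverse_iff)
    then show ?thesis using x by auto
  qed (use x in auto)
qed

lemma av_lt_1: "\<exists>x\<in>K. x \<noteq> 0 \<and> v x < 1"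
proof -
  obtain x where "x \<in> K" "v x > 1" using av_gt_1 by auto
  then show ?thesis
    by (intro bexI[of _ "inverse x"]) (auto simp: av_inverse inverse_less_1_iff)
qed

lemma av_of_nat_le: "v (of_nat n) \<le> n"
proof (induction n)
  case (Suc n)
  then show ?case using av_add[of "of_nat n" 1] by (simp add: add.commute)
qed auto

end

section \<open>Equivalence of absolute values\<close>

lemma abs_value_equiv_iff:
  "(v, w) \<in> abs_value_equiv K \<longleftrightarrow> absval v \<and> absval w \<and> (\<exists>s>0. \<forall>x\<in>K. w x = v x powr s)"
  by (simp add: abs_value_equiv_def absval_def)

lemma equiv_abs_value_equiv: "equiv (nontrivial_abs_values K) (abs_value_equiv K)"
proof (rule equivI)
  show "abs_value_equiv K \<subseteq> nontrivial_abs_values K \<times> nontrivial_abs_values K"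
    by (auto simp: abs_value_equiv_def)
  show "refl_on (nontrivial_abs_values K) (abs_value_equiv K)"
    unfolding refl_on_def abs_value_equiv_iff
    by (auto simp: absval_def[symmetric] intro!: exI[of _ "1::real"])
  show "sym (abs_value_equiv K)"
  proof (rule symI)
    fix v w assume "(v, w) \<in> abs_value_equiv K"
    then obtain s where s: "absval v" "absval w" "s > 0" "\<forall>x\<in>K. w x = v x powr s"
      unfolding abs_value_equiv_iff by blast
    then have "\<forall>x\<in>K. v x = w x powr (1/s)"
      by (auto simp: powr_powr)
    with s show "(w, v) \<in> abs_value_equiv K"
      unfolding abs_value_equiv_iff by (auto intro!: exI[of _ "1/s"])
  qed
  show "trans (abs_value_equiv K)"
  proof (rule transI)
    fix u v w assume "(u, v) \<in> abs_value_equiv K" "(v, w) \<in> abs_value_equiv K"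
    then obtain s t where "absval u" "absval w" "s > 0" "\<forall>x\<in>K. v x = u x powr s"
      "t > 0" "\<forall>x\<in>K. w x = v x powr t"
      unfolding abs_value_equiv_iff by blast
    then show "(u, w) \<in> abs_value_equiv K"
      unfolding abs_value_equiv_iff by (auto simp: powr_powr intro!: exI[of _ "s*t"])
  qed
qed

lemma equiv_less_1:
  assumes "(v, w) \<in> abs_value_equiv K" and x: "x \<in> K"
  shows "w x < 1 \<longleftrightarrow> v x < 1"
proof -
  obtain s where s: "absval v" "s > 0" "w x = v x powr s"
    using assms unfolding abs_value_equiv_iff by blast
  have "v x powr s < 1 powr s" if "v x < 1"
    using s x that by (intro powr_less_mono2) auto
  moreover have "v x powr s \<ge> 1" if "v x \<ge> 1"
    using s that by (simp add: ge_one_powr_ge_zero)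
  ultimately show ?thesis using s by fastforce
qed

text \<open>For a fixed \<open>a\<close> with \<open>v a < 1\<close>, the ratios
  \<open>ln (v x) / ln (v a)\<close> and \<open>ln (w x) / ln (w a)\<close> must agree: a rational
  number strictly between them would give a product of powers of \<open>x\<close> and
  \<open>a\<close> that is small for \<open>v\<close> but large for \<open>w\<close>. This excludes
  one inequality; the other follows by passing to \<open>inverse x\<close>.\<close>

lemma abs_value_equivI:
  assumes v: "absval v" and w: "absval w" and imp: "\<And>x. x \<in> K \<Longrightarrow> v x < 1 \<Longrightarrow> w x < 1"
  shows "(v, w) \<in> abs_value_equiv K"
proof -
  obtain a where a: "a \<in> K" "a \<noteq> 0" "v a < 1"
    using av_lt_1[OF v] by auto
  have wa: "w a < 1" using imp a by simp
  define s where "s = ln (w a) / ln (v a)"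
  have lva: "ln (v a) < 0" and lwa: "ln (w a) < 0"
    using a wa v w by simp_all
  have le: "ln (v x) / ln (v a) \<le> ln (w x) / ln (w a)" if x: "x \<in> K" "x \<noteq> 0" for x
  proof (rule ccontr)
    assume "\<not> ?thesis"
    then have "ln (w x) / ln (w a) < ln (v x) / ln (v a)" by simp
    from Rats_dense_in_real[OF this]
    obtain r where r: "r \<in> \<rat>" "ln (w x) / ln (w a) < r" "r < ln (v x) / ln (v a)"
      by blast
    obtain m b :: int where mb: "b > 0" "r = of_int m / of_int b"
      using \<open>r \<in> \<rat>\<close> by (rule Rats_cases')
    define n where "n = nat b"
    have mn: "n > 0" "r = of_int m / of_nat n"
      using mb by (simp_all add: n_def)
    define y where "y = x ^ n * a powi (- m)"
    have y: "y \<in> K" using x a by (simp add: y_def)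
    have ln_y: "ln (u y) = n * ln (u x) - m * ln (u a)" and upos: "u y > 0" if "absval u" for u
    proof -
      have pos: "u x > 0" "u a > 0" using that x a by simp_all
      have uy: "u y = u x ^ n * u a powi (- m)"
        using that x a by (simp add: y_def av_mult av_power av_power_int)
      show "u y > 0"
        unfolding uy using pos by simp
      have "ln (u a powi (- m)) = - m * ln (u a)"
        using powr_real_of_int'[of "u a" "- m"] ln_powr[of "u a" "- real_of_int m"] pos by simp
      then show "ln (u y) = n * ln (u x) - m * ln (u a)"
        unfolding uy using pos by (subst ln_mult) (simp_all add: ln_realpow)
    qed
    have "ln (v y) < 0"
      using r(3) lva mn unfolding ln_y[OF v] by (simp add: field_simps)
    then have "v y < 1" using upos[OF v] by simp
    then have "w y < 1" using imp y by simp
    then have "ln (w y) < 0" using upos[OF w] by simp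
    then show False
      using r(2) lwa mn unfolding ln_y[OF w] by (simp add: field_simps)
  qed
  have "w x = v x powr s" if x: "x \<in> K" for x
  proof (cases "x = 0")
    case False
    have "ln (v (inverse x)) = - ln (v x)" "ln (w (inverse x)) = - ln (w x)"
      using x v w by (simp_all add: av_inverse ln_inverse)
    then have "ln (v x) / ln (v a) = ln (w x) / ln (w a)"
      using le[of x] le[of "inverse x"] x False by simp
    then have "ln (w x) = s * ln (v x)"
      using lva lwa by (simp add: s_def field_simps)
    moreover have "v x > 0" "w x > 0" using x v w False by simp_all
    ultimately show ?thesis
      by (metis exp_ln powr_def less_irrefl)
  qed (use v w in simp)
  moreover have "s > 0" using lva lwa by (simp add: s_def divide_neg_neg)
  ultimately show ?thesis
    using v w unfolding abs_value_equiv_iff by blast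
qed

section \<open>Weak approximation\<close>

text \<open>Inequivalence yields \<open>a\<close> that is small for \<open>v\<close> but not for
  \<open>w\<close>, and \<open>b\<close> with the roles exchanged; the quotient \<open>b / a\<close>
  separates strictly on both sides.\<close>

lemma separate_two:
  assumes v: "absval v" and w: "absval w" and "(v, w) \<notin> abs_value_equiv K"
  shows "\<exists>x\<in>K. v x > 1 \<and> w x < 1"
proof -
  have "(w, v) \<notin> abs_value_equiv K"
    using assms(3) equiv_abs_value_equiv by (meson equivE symE)
  then obtain a b where a: "a \<in> K" "v a < 1" "w a \<ge> 1" and b: "b \<in> K" "w b < 1" "v b \<ge> 1"
    using assms abs_value_equivI by (metis linorder_not_less)
  have "v a > 0" "w a > 0" using a v w by auto
  then have "v (b / a) > 1" "w (b / a) < 1"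
    using a b v w by (auto simp: av_divide field_simps)
  then show ?thesis using a b by (intro bexI[of _ "b/a"]) auto
qed

text \<open>In the inductive step \<open>x\<close> separates \<open>v\<close> from \<open>V\<close>,
  and \<open>y\<close> separates \<open>v\<close> from the new \<open>w\<close>. If
  \<open>w x \<le> 1\<close>, multiplying \<open>y\<close> by a high power of \<open>x\<close> makes
  it small on \<open>V\<close> without spoiling it at \<open>w\<close>. If \<open>w x > 1\<close>,
  powers of \<open>x\<close> would spoil it there, and a bounded multiplier is needed.\<close>

lemma separate_finite:
  assumes "finite V" and "absval v" and "\<And>w. w \<in> V \<Longrightarrow> absval w \<and> (v, w) \<notin> abs_value_equiv K"
  shows "\<exists>x\<in>K. v x > 1 \<and> (\<forall>w\<in>V. w x < 1)"
  using assms
proof (induction V)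
  case empty
  then show ?case using av_gt_1 by auto
next
  case (insert w V)
  note v = \<open>absval v\<close>
  have w: "absval w" and V: "\<And>u. u \<in> V \<Longrightarrow> absval u" using insert by auto
  obtain x where x: "x \<in> K" "v x > 1" "\<And>u. u \<in> V \<Longrightarrow> u x < 1"
    using insert by (metis insertCI)
  obtain y where y: "y \<in> K" "v y > 1" "w y < 1"
    using separate_two[OF v w] insert by auto
  define P where "P N z \<longleftrightarrow> z \<in> K \<and> v z > 1 \<and> (\<forall>u\<in>insert w V. u z < 1)" for N :: nat and z
  have to0: "(\<lambda>N. u x ^ N) \<longlonglongrightarrow> 0" if "u \<in> V" for u
    using x(1) x(3)[OF that] V[OF that] by (intro LIMSEQ_power_zero) auto
  show ?case
  proof (cases "w x \<le> 1")
    case True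
    have "\<forall>\<^sub>F N in sequentially. u (x ^ N * y) < 1" if u: "u \<in> V" for u
    proof -
      have "(\<lambda>N. u x ^ N * u y) \<longlonglongrightarrow> 0 * u y"
        by (intro tendsto_intros to0 u)
      then have "\<forall>\<^sub>F N in sequentially. u x ^ N * u y < 1"
        by (rule order_tendstoD) simp
      then show ?thesis using x y V[OF u] by (simp add: av_mult av_power)
    qed
    then have "\<forall>\<^sub>F N in sequentially. \<forall>u\<in>V. u (x ^ N * y) < 1"
      using insert(1) by (simp add: eventually_ball_finite)
    then obtain N where N: "\<forall>u\<in>V. u (x ^ N * y) < 1"
      using eventually_happens trivial_limit_sequentially by blast
    have "w x ^ N * w y \<le> 1 * w y"
      using True x y w by (intro mult_right_mono power_le_one) auto
    moreover have "v x ^ N \<ge> 1" using x by simp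
    then have "v x ^ N * v y > 1" using y by (metis less_1_mult' mult.commute)
    ultimately have "v (x ^ N * y) > 1" "w (x ^ N * y) < 1"
      using v w x y by (auto simp: av_mult av_power)
    then show ?thesis using N x y by (intro bexI[of _ "x ^ N * y"]) auto
  next
    case False
    \<comment> \<open>The multiplier tends to 1 where \<open>x\<close> is large and to 0 where
      \<open>x\<close> is small, so \<open>z N\<close> behaves like \<open>y\<close> at
      \<open>v\<close> and \<open>w\<close> and tends to 0 on \<open>V\<close>.\<close>
    define z where "z N = x ^ N / (1 + x ^ N) * y" for N
    have zK: "z N \<in> K" for N using x y by (simp add: z_def)
    have lim1: "(\<lambda>N. u (z N)) \<longlonglongrightarrow> u y" if u: "absval u" "u x > 1" for u
    proof -
      have x0: "x \<noteq> 0" using u by auto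
      have inv0: "(\<lambda>N. inverse (u x) ^ N) \<longlonglongrightarrow> 0"
        using u x by (intro LIMSEQ_power_zero) (auto simp: inverse_less_1_iff)
      have "\<bar>u (1 + inverse x ^ N) - 1\<bar> \<le> inverse (u x) ^ N" for N
      proof -
        have *: "u (inverse x ^ N) = inverse (u x) ^ N"
          using u x by (simp add: av_power av_inverse)
        have "u (1 + inverse x ^ N) \<le> 1 + inverse (u x) ^ N"
          using av_add[OF u(1), of 1 "inverse x ^ N"] u x * by simp
        moreover have "u ((1 + inverse x ^ N) + - (inverse x ^ N)) \<le> u (1 + inverse x ^ N) + inverse (u x) ^ N"
          using av_add[OF u(1), of "1 + inverse x ^ N" "- (inverse x ^ N)"] u x * by simp
        ultimately show ?thesis using u by simp
      qed
      then have "(\<lambda>N. u (1 + inverse x ^ N) - 1) \<longlonglongrightarrow> 0"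
        by (intro Lim_null_comparison[OF _ inv0] always_eventually) simp
      then have "(\<lambda>N. u (1 + inverse x ^ N)) \<longlonglongrightarrow> 1"
        by (simp add: LIM_zero_iff)
      then have "(\<lambda>N. inverse (u (1 + inverse x ^ N)) * u y) \<longlonglongrightarrow> inverse 1 * u y"
        by (intro tendsto_intros) auto
      moreover have "u (z N) = inverse (u (1 + inverse x ^ N)) * u y" for N
      proof -
        have "z N = inverse (1 + inverse x ^ N) * y"
          using x0 by (simp add: z_def field_simps)
        then show ?thesis using u x y by (simp add: av_mult av_inverse)
      qed
      ultimately show ?thesis by simp
    qed
    have lim0: "(\<lambda>N. u (z N)) \<longlonglongrightarrow> 0" if u: "u \<in> V" for u
    proof -
      note au = V[OF u]
      have "\<bar>u (1 + x ^ N) - 1\<bar> \<le> u x ^ N" for N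
      proof -
        have "u (1 + x ^ N) \<le> 1 + u x ^ N"
          using av_add[OF au, of 1 "x ^ N"] au x by (simp add: av_power)
        moreover have "u ((1 + x ^ N) + - (x ^ N)) \<le> u (1 + x ^ N) + u x ^ N"
          using av_add[OF au, of "1 + x ^ N" "- (x ^ N)"] au x by (simp add: av_power)
        ultimately show ?thesis using au by simp
      qed
      then have "(\<lambda>N. u (1 + x ^ N) - 1) \<longlonglongrightarrow> 0"
        by (intro Lim_null_comparison[OF _ to0[OF u]] always_eventually) simp
      then have "(\<lambda>N. u (1 + x ^ N)) \<longlonglongrightarrow> 1"
        by (simp add: LIM_zero_iff)
      then have "(\<lambda>N. u x ^ N / u (1 + x ^ N) * u y) \<longlonglongrightarrow> 0 / 1 * u y"
        by (intro tendsto_intros to0 u) auto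
      then show ?thesis using au x y by (simp add: z_def av_mult av_divide av_power)
    qed
    have "\<forall>\<^sub>F N in sequentially. \<forall>u\<in>V. u (z N) < 1"
      using insert(1) order_tendstoD(2)[OF lim0, of _ 1] by (simp add: eventually_ball_finite_distrib)
    moreover have "\<forall>\<^sub>F N in sequentially. v (z N) > 1"
      using order_tendstoD(1)[OF lim1[OF v]] x y by blast
    moreover have "\<forall>\<^sub>F N in sequentially. w (z N) < 1"
      using order_tendstoD(2)[OF lim1[OF w]] y False by auto
    ultimately have "\<forall>\<^sub>F N in sequentially. (\<forall>u\<in>V. u (z N) < 1) \<and> v (z N) > 1 \<and> w (z N) < 1"
      by (intro eventually_conj)
    then obtain N where "(\<forall>u\<in>V. u (z N) < 1) \<and> v (z N) > 1 \<and> w (z N) < 1"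
      using eventually_happens trivial_limit_sequentially by blast
    then show ?thesis using zK by blast
  qed
qed

end

text \<open>Exponential growth beats linear growth. Applied to \<open>N\<close>-th powers of an
  estimate this removes a factor linear in \<open>N\<close>: the number of binomial terms in
  \<open>ultrametricI\<close>, the number of digits in \<open>av_nat_le_powr\<close>.\<close>

lemma power_le_linear_imp_le_1:
  fixes r C :: real
  assumes "\<And>N. r ^ N \<le> C * (real N + 1)"
  shows "r \<le> 1"
proof (rule ccontr)
  assume "\<not> r \<le> 1"
  then have r: "r > 1" by simp
  have "(\<lambda>N. real N / r ^ N) \<longlonglongrightarrow> 0"
    using lim_n_over_pown[of r] r by simp
  moreover have "(\<lambda>N. inverse (r ^ N)) \<longlonglongrightarrow> 0"
    by (rule LIMSEQ_inverse_realpow_zero[OF r])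
  ultimately have "(\<lambda>N. C * (real N / r ^ N + inverse (r ^ N))) \<longlonglongrightarrow> C * (0 + 0)"
    by (intro tendsto_intros)
  moreover have "C * (real N / r ^ N + inverse (r ^ N)) \<ge> 1" for N
    using assms[of N] r by (simp add: field_simps)
  ultimately have "1 \<le> C * (0 + 0)"
    by (intro LIMSEQ_le_const) auto
  then show False by simp
qed

context num_field
begin

section \<open>Places that order the rationals alike\<close>

lemma place_absval: "\<nu> \<in> places K \<Longrightarrow> v \<in> \<nu> \<Longrightarrow> absval v"
  unfolding places_def absval_def
  using in_quotient_imp_subset[OF equiv_abs_value_equiv] by blast

lemma place_equiv: "\<nu> \<in> places K \<Longrightarrow> v \<in> \<nu> \<Longrightarrow> w \<in> \<nu> \<Longrightarrow> (v, w) \<in> abs_value_equiv K"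
  unfolding places_def using quotient_eq_iff[OF equiv_abs_value_equiv] by blast

lemma place_eqI:
  "\<nu> \<in> places K \<Longrightarrow> \<mu> \<in> places K \<Longrightarrow> v \<in> \<nu> \<Longrightarrow> w \<in> \<mu> \<Longrightarrow> (v, w) \<in> abs_value_equiv K \<Longrightarrow> \<nu> = \<mu>"
  unfolding places_def using quotient_eq_iff[OF equiv_abs_value_equiv] by blast

lemma place_nonempty: "\<nu> \<in> places K \<Longrightarrow> \<exists>v. v \<in> \<nu>"
  unfolding places_def using in_quotient_imp_non_empty[OF equiv_abs_value_equiv] by blast

text \<open>Weak approximation gives \<open>X v\<close> large at \<open>v\<close> and small at the
  other members of \<open>V\<close>. In a rational relation between these elements consider a
  coefficient of maximal absolute value: all members of \<open>V\<close> agree on which one is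
  maximal, so at the member \<open>v\<close> to which it belongs its term exceeds the sum of all
  others.\<close>

lemma card_le_of_same_order_on_rat:
  assumes B: "finite B" "K = rat_vs.span B" and fin: "finite V"
    and V: "\<And>v. v \<in> V \<Longrightarrow> absval v"
    and ineq: "\<And>v w. v \<in> V \<Longrightarrow> w \<in> V \<Longrightarrow> v \<noteq> w \<Longrightarrow> (v, w) \<notin> abs_value_equiv K"
    and ord: "\<And>v w c d. v \<in> V \<Longrightarrow> w \<in> V \<Longrightarrow> v (of_rat c) \<le> v (of_rat d) \<Longrightarrow> w (of_rat c) \<le> w (of_rat d)"
  shows "card V \<le> card B"
proof -
  \<comment> \<open>The threshold \<open>card V\<close> lets one term outweigh the fewer than
    \<open>card V\<close> others, each of which is bounded by the largest coefficient.\<close>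
  have "\<exists>x\<in>K. v x > card V \<and> (\<forall>w\<in>V - {v}. w x < 1)" if v: "v \<in> V" for v
  proof -
    obtain x where x: "x \<in> K" "v x > 1" "\<forall>w\<in>V - {v}. w x < 1"
      using separate_finite[of "V - {v}" v] fin v V ineq by auto
    obtain N where "v x ^ N > card V"
      using real_arch_pow[OF x(2)] by blast
    \<comment> \<open>A positive exponent is needed to keep the values at the other members strictly
      below 1.\<close>
    then have N: "v x ^ Suc N > card V"
      using x(2) power_increasing[of N "Suc N" "v x"] by linarith
    have "w x ^ Suc N < 1" if "w \<in> V - {v}" for w
    proof (rule power_Suc_less_one)
      have "x \<noteq> 0" using x(2) V[OF v] by auto
      then show "0 < w x" "w x < 1" using x that V by auto
    qed
    then have "v (x ^ Suc N) > card V \<and> (\<forall>w\<in>V - {v}. w (x ^ Suc N) < 1)"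
      using N V v x by (simp add: av_power del: power_Suc)
    then show ?thesis using x by (intro bexI[of _ "x ^ Suc N"]) auto
  qed
  then obtain X where X: "\<And>v. v \<in> V \<Longrightarrow> X v \<in> K \<and> v (X v) > card V"
      "\<And>v w. v \<in> V \<Longrightarrow> w \<in> V \<Longrightarrow> w \<noteq> v \<Longrightarrow> w (X v) < 1"
    by (metis DiffI singletonD)
  have inj: "inj_on X V"
  proof (rule inj_onI, rule ccontr)
    fix v w assume "v \<in> V" "w \<in> V" "X v = X w" "v \<noteq> w"
    moreover from this have "v (X w) < 1" "v (X v) > card V" "card V \<ge> 1"
      using X(2)[of w v] X(1)[of v] fin by (auto simp: Suc_le_eq card_gt_0_iff)
    ultimately show False by simp
  qed
  have "rat_vs.independent (X ` V)"
  proof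
    assume "rat_vs.dependent (X ` V)"
    then obtain c where c: "\<exists>x\<in>X ` V. c x \<noteq> 0" "(\<Sum>x\<in>X ` V. of_rat (c x) * x) = 0"
      using rat_vs.dependent_finite[of "X ` V"] fin by auto
    define b where "b v = c (X v)" for v
    have b: "\<exists>v\<in>V. b v \<noteq> 0" "(\<Sum>v\<in>V. of_rat (b v) * X v) = 0"
      using c by (auto simp: b_def sum.reindex[OF inj])
    then obtain v0 where v0: "v0 \<in> V" "b v0 \<noteq> 0" by blast
    \<comment> \<open>The maximum is formed at \<open>v0\<close>, any index with nonzero
      coefficient; \<open>ord\<close> then transfers it to the maximizing index \<open>v\<close>
      itself.\<close>
    have "Max ((\<lambda>v. v0 (of_rat (b v))) ` V) \<in> (\<lambda>v. v0 (of_rat (b v))) ` V"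
      using fin v0 by (intro Max_in) auto
    then obtain v where vV: "v \<in> V" and veq: "Max ((\<lambda>v. v0 (of_rat (b v))) ` V) = v0 (of_rat (b v))"
      by blast
    have vmax: "v0 (of_rat (b w)) \<le> v0 (of_rat (b v))" if "w \<in> V" for w
      unfolding veq[symmetric] using fin that by (intro Max_ge) auto
    have max: "v (of_rat (b w)) \<le> v (of_rat (b v))" if "w \<in> V" for w
      using vmax[OF that] ord[of v0 v] v0 vV by blast
    have "v0 (of_rat (b v0)) > 0" using v0 V by simp
    then have "v0 (of_rat (b v)) > 0" using vmax[OF v0(1)] by linarith
    then have bv: "b v \<noteq> 0" using V v0 by auto
    have "of_rat (b v) * X v = - (\<Sum>w\<in>V - {v}. of_rat (b w) * X w)"
      using b(2) vV fin by (simp add: sum.remove add_eq_0_iff)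
    then have "v (of_rat (b v)) * v (X v) = v (\<Sum>w\<in>V - {v}. of_rat (b w) * X w)"
      using av_mult[OF V[OF vV], of "of_rat (b v)" "X v"] X(1)[OF vV]
        av_minus[OF V[OF vV] sum_mem[of "V - {v}" "\<lambda>w. of_rat (b w) * X w"]] X(1) by simp
    also have "\<dots> \<le> (\<Sum>w\<in>V - {v}. v (of_rat (b w) * X w))"
      using V vV X by (intro av_sum) auto
    also have "\<dots> \<le> (\<Sum>w\<in>V - {v}. v (of_rat (b v)) * 1)"
    proof (rule sum_mono)
      fix w assume w: "w \<in> V - {v}"
      then have "v (X w) \<le> 1" using X(2)[of w v] vV by auto
      then show "v (of_rat (b w) * X w) \<le> v (of_rat (b v)) * 1"
        using w X(1)[of w]
        by (intro ord_eq_le_trans[OF av_mult[OF V[OF vV]]] mult_mono max) (auto simp: V[OF vV])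
    qed
    also have "\<dots> \<le> v (of_rat (b v)) * card V"
    proof -
      have "v (of_rat (b v)) * card (V - {v}) \<le> v (of_rat (b v)) * card V"
        using V[OF vV] fin by (intro mult_left_mono) (auto intro!: card_mono)
      then show ?thesis by (simp add: mult.commute)
    qed
    finally show False
      using X(1)[OF vV] bv V[OF vV] by simp
  qed
  moreover have "X ` V \<subseteq> rat_vs.span B" using X B by auto
  ultimately have "card (X ` V) \<le> card B"
    using rat_vs.independent_span_bound[OF B(1)] by blast
  then show ?thesis using inj by (simp add: card_image)
qed

text \<open>Representatives of more than \<open>card B\<close> such places would violate the
  preceding bound. The order \<open>R\<close> is a parameter because two kinds occur: the usual
  order of absolute values and, for each prime, the p-adic one.\<close>

lemma finite_places_same_order_on_rat:
  "finite {\<nu> \<in> places K. \<exists>v\<in>\<nu>. \<forall>c d. v (of_rat c) \<le> v (of_rat d) \<longleftrightarrow> R c d}" (is "finite ?T")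
proof (rule ccontr)
  assume inf: "infinite ?T"
  obtain B where B: "finite B" "K = rat_vs.span B"
    using num_field unfolding number_field_iff_span by blast
  obtain T where T: "T \<subseteq> ?T" "finite T" "card T = Suc (card B)"
    using infinite_arbitrarily_large[OF inf] by blast
  define r where "r \<nu> = (SOME v. v \<in> \<nu> \<and> (\<forall>c d. v (of_rat c) \<le> v (of_rat d) \<longleftrightarrow> R c d))" for \<nu> :: "(complex \<Rightarrow> real) set"
  have r: "r \<nu> \<in> \<nu>" "\<And>c d. r \<nu> (of_rat c) \<le> r \<nu> (of_rat d) \<longleftrightarrow> R c d" "\<nu> \<in> places K" if "\<nu> \<in> T" for \<nu>
  proof -
    have "\<exists>v. v \<in> \<nu> \<and> (\<forall>c d. v (of_rat c) \<le> v (of_rat d) \<longleftrightarrow> R c d)" "\<nu> \<in> places K"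
      using T that by auto
    from this(2) someI_ex[OF this(1)] show "r \<nu> \<in> \<nu>" "\<And>c d. r \<nu> (of_rat c) \<le> r \<nu> (of_rat d) \<longleftrightarrow> R c d" "\<nu> \<in> places K"
      unfolding r_def by auto
  qed
  have eq: "\<nu> = \<mu>" if "\<nu> \<in> T" "\<mu> \<in> T" "(r \<nu>, r \<mu>) \<in> abs_value_equiv K" for \<nu> \<mu>
    using place_eqI[OF r(3)[OF that(1)] r(3)[OF that(2)] r(1)[OF that(1)] r(1)[OF that(2)] that(3)] .
  have refl: "(r \<nu>, r \<nu>) \<in> abs_value_equiv K" if "\<nu> \<in> T" for \<nu>
    using place_equiv[OF r(3)[OF that] r(1)[OF that] r(1)[OF that]] .
  have "inj_on r T"
  proof (rule inj_onI)
    fix \<nu> \<mu> assume "\<nu> \<in> T" "\<mu> \<in> T" "r \<nu> = r \<mu>"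
    then show "\<nu> = \<mu>" using eq[of \<nu> \<mu>] refl[of \<nu>] by simp
  qed
  moreover have "card (r ` T) \<le> card B"
  proof (rule card_le_of_same_order_on_rat[OF B])
    show "absval v" if "v \<in> r ` T" for v
      using that place_absval[OF r(3) r(1)] by auto
    show "(v, w) \<notin> abs_value_equiv K" if "v \<in> r ` T" "w \<in> r ` T" "v \<noteq> w" for v w
      using that eq by auto
    show "w (of_rat c) \<le> w (of_rat d)" if "v \<in> r ` T" "w \<in> r ` T" "v (of_rat c) \<le> v (of_rat d)" for v w c d
      using that by (auto simp: r(2))
  qed (use T in simp)
  ultimately show False
    using T by (simp add: card_image)
qed

section \<open>Archimedean places and Ostrowski's theorem\<close>

text \<open>The binomial expansion of \<open>(x + y) ^ N\<close> has \<open>N + 1\<close> terms,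
  each of value at most \<open>M ^ N\<close> since binomial coefficients are natural numbers; the
  factor \<open>N + 1\<close> is absorbed by letting \<open>N\<close> grow.\<close>

lemma ultrametricI:
  assumes v: "absval v" and le: "\<And>n. v (of_nat n) \<le> 1" and x: "x \<in> K" and y: "y \<in> K"
  shows "v (x + y) \<le> max (v x) (v y)"
proof (cases "max (v x) (v y) = 0")
  case True
  then have "v x = 0" "v y = 0" using av_nonneg[OF v] x y by (metis max.cobounded1 max.cobounded2 order_antisym)+
  then show ?thesis using x y v by simp
next
  case False
  define M where "M = max (v x) (v y)"
  have M: "M > 0" "v x \<le> M" "v y \<le> M"
    using False av_nonneg[OF v x] unfolding M_def by linarith+
  have "(v (x + y) / M) ^ N \<le> 1 * (real N + 1)" for N
  proof -
    have "v (x + y) ^ N = v (\<Sum>k\<le>N. of_nat (N choose k) * x ^ k * y ^ (N - k))"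
      using x y v by (simp add: av_power[symmetric] binomial_ring)
    also have "\<dots> \<le> (\<Sum>k\<le>N. v (of_nat (N choose k) * x ^ k * y ^ (N - k)))"
      using x y by (intro av_sum v) auto
    also have "\<dots> \<le> (\<Sum>k\<le>N. M ^ N)"
    proof (rule sum_mono)
      fix k assume k: "k \<in> {..N}"
      have "v (of_nat (N choose k) * x ^ k * y ^ (N - k)) = v (of_nat (N choose k)) * v x ^ k * v y ^ (N - k)"
        using x y v by (simp add: av_mult av_power)
      also have "\<dots> \<le> 1 * M ^ k * M ^ (N - k)"
        using x y v M le by (intro mult_mono power_mono) auto
      finally show "v (of_nat (N choose k) * x ^ k * y ^ (N - k)) \<le> M ^ N"
        using k by (simp flip: power_add)
    qed
    finally have "v (x + y) ^ N \<le> (real N + 1) * M ^ N" by (simp add: add.commute)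
    then show ?thesis using M by (simp add: power_divide divide_simps)
  qed
  then have "v (x + y) / M \<le> 1" by (rule power_le_linear_imp_le_1)
  then show ?thesis using M unfolding M_def by (simp add: divide_simps split: if_splits)
qed

text \<open>Evaluate \<open>a\<close> from its digits in base \<open>n\<close>: there are at most
  \<open>k\<close> of them, each of value at most \<open>n\<close>, and every further position
  multiplies by \<open>v (of_nat n)\<close>, which is at most \<open>M\<close>.\<close>

lemma av_nat_digits_le:
  fixes M :: real
  assumes v: "absval v" and n: "n \<ge> 1" and M: "M \<ge> 1" "M \<ge> v (of_nat n)"
  shows "a < n ^ k \<Longrightarrow> v (of_nat a) \<le> real n * real k * M ^ k"
proof (induction k arbitrary: a)
  case (Suc k)
  have "a div n < n ^ k"
    using Suc.prems by (simp add: less_mult_imp_div_less mult.commute)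
  then have IH: "v (of_nat (a div n)) \<le> real n * real k * M ^ k" by (rule Suc.IH)
  have "v (of_nat a) = v (of_nat n * of_nat (a div n) + of_nat (a mod n))"
    by (metis mult_div_mod_eq of_nat_add of_nat_mult)
  also have "\<dots> \<le> v (of_nat n) * v (of_nat (a div n)) + v (of_nat (a mod n))"
    using av_add[OF v, of "of_nat n * of_nat (a div n)" "of_nat (a mod n)"] v by (simp add: av_mult)
  also have "\<dots> \<le> M * (real n * real k * M ^ k) + n * M ^ Suc k"
  proof (intro add_mono mult_mono IH M)
    have "v (of_nat (a mod n)) \<le> real (a mod n)" by (rule av_of_nat_le[OF v])
    also have "\<dots> \<le> real n * 1" using n by (simp add: less_imp_le)
    also have "\<dots> \<le> real n * M ^ Suc k" using M by (intro mult_left_mono one_le_power) auto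
    finally show "v (of_nat (a mod n)) \<le> n * M ^ Suc k" .
  qed (use M v in auto)
  also have "\<dots> = real n * real (Suc k) * M ^ Suc k" by (simp add: algebra_simps)
  finally show ?case .
qed (use v in simp)

text \<open>The digit bound is applied to \<open>m ^ N\<close>, which has about
  \<open>N * (ln m / ln n)\<close> digits in base \<open>n\<close>; for large \<open>N\<close> the
  constant and the number of digits become irrelevant.\<close>

lemma av_nat_le_powr:
  assumes v: "absval v" and m: "m \<ge> 2" and n: "n \<ge> 2"
  shows "v (of_nat m) \<le> max 1 (v (of_nat n)) powr (ln m / ln n)"
proof -
  define l where "l = ln (real m) / ln (real n)"
  define M where "M = max 1 (v (of_nat n))"
  have l: "l > 0" using m n by (simp add: l_def)
  have M: "M \<ge> 1" "M \<ge> v (of_nat n)" by (auto simp: M_def)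
  have nl: "real n powr l = m"
    using m n by (simp add: l_def powr_def)
  have "(v (of_nat m) / M powr l) ^ N \<le> (n * (l + 1) * M) * (real N + 1)" for N
  proof -
    \<comment> \<open>Adding 1 to the floor makes \<open>m ^ N < n ^ k\<close> strict, as the digit
      bound requires.\<close>
    define k where "k = nat \<lfloor>N * l\<rfloor> + 1"
    have k: "N * l < k" "k \<le> N * l + 1"
      using l unfolding k_def by (auto simp: of_nat_nat) linarith+
    have "real (m ^ N) = (real n powr l) ^ N" by (simp add: nl)
    also have "\<dots> = n powr (N * l)"
      using powr_realpow[of "real n powr l" N] n by (simp add: powr_powr mult.commute)
    also have "\<dots> < n powr k" using k n by simp
    also have "\<dots> = real (n ^ k)" using n by (simp add: powr_realpow)
    finally have "m ^ N < n ^ k" by (simp only: of_nat_less_iff)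
    then have "v (of_nat (m ^ N)) \<le> real n * real k * M ^ k"
      using n by (intro av_nat_digits_le v M) auto
    then have "v (of_nat m) ^ N \<le> real n * real k * M ^ k" using v by (simp add: av_power)
    also have "M ^ k = M powr k" using M by (simp add: powr_realpow)
    also have "real n * real k * M powr k \<le> real n * ((l + 1) * (real N + 1)) * M powr (N * l + 1)"
    proof (intro mult_mono powr_mono)
      show "real k \<le> (l + 1) * (real N + 1)" using k l by (simp add: algebra_simps)
    qed (use M k l in auto)
    also have "M powr (N * l + 1) = (M powr l) ^ N * M"
      using M by (simp add: powr_add powr_powr mult.commute flip: powr_realpow)
    finally show ?thesis using M by (simp add: power_divide divide_simps mult_ac)
  qed
  then have "v (of_nat m) / M powr l \<le> 1" by (rule power_le_linear_imp_le_1)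
  then show ?thesis using M unfolding M_def[symmetric] l_def[symmetric] by (simp add: divide_simps split: if_splits)
qed

text \<open>One integer of value above 1 forces all integers from 2 on to have value above 1, so the
  maximum with 1 in \<open>av_nat_le_powr\<close> disappears. That bound also holds with
  \<open>m\<close> and \<open>n\<close> exchanged, hence \<open>ln (v (of_nat n)) / ln n\<close> is
  constant; this constant is the exponent.\<close>

lemma ostrowski_archimedean:
  assumes v: "absval v" and m: "v (of_nat m) > 1"
  shows "\<exists>s>0. \<forall>c. v (of_rat c) = \<bar>of_rat c\<bar> powr s"
proof -
  have m2: "m \<ge> 2"
  proof (rule ccontr)
    assume "\<not> m \<ge> 2"
    then have "m = 0 \<or> m = 1" by auto
    then show False using m v by auto
  qed
  have gt: "v (of_nat n) > 1" if "n \<ge> 2" for n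
  proof (rule ccontr)
    assume "\<not> ?thesis"
    then show False using av_nat_le_powr[OF v m2 that] m by (simp add: max_def split: if_splits)
  qed
  have le: "ln (v (of_nat k)) / ln k \<le> ln (v (of_nat n)) / ln n" if "k \<ge> 2" "n \<ge> 2" for k n :: nat
  proof -
    have "v (of_nat k) \<le> v (of_nat n) powr (ln k / ln n)"
      using av_nat_le_powr[OF v that] gt[OF that(2)] by (simp add: max_def)
    then have "ln (v (of_nat k)) \<le> ln (v (of_nat n) powr (ln k / ln n))"
      using gt[OF that(1)] by (subst ln_le_cancel_iff) auto
    also have "\<dots> = ln k / ln n * ln (v (of_nat n))"
      using gt[OF that(2)] by (simp add: ln_powr)
    finally show ?thesis using that by (simp add: field_simps)
  qed
  define s where "s = ln (v (of_nat 2)) / ln (2::real)"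
  have s: "s > 0" using gt[of 2] by (simp add: s_def)
  have nat: "v (of_nat n) = real n powr s" for n
  proof -
    consider "n = 0" | "n = 1" | "n \<ge> 2" by linarith
    then show ?thesis
    proof cases
      case 3
      then have "ln (v (of_nat n)) / ln n = s"
        using le[of n 2] le[of 2 n] by (simp add: s_def)
      then have "ln (v (of_nat n)) = s * ln n" using 3 by (simp add: field_simps)
      then show ?thesis using gt[OF 3] 3 exp_ln[of "v (of_nat n)"] by (simp add: powr_def)
    qed (use v in auto)
  qed
  have int: "v (of_int n) = \<bar>real_of_int n\<bar> powr s" for n
    using v nat by (cases n) (auto simp del: of_nat_Suc)
  have "v (of_rat c) = \<bar>of_rat c\<bar> powr s" for c
    using v int by (cases c) (auto simp: of_rat_rat av_divide powr_divide)
  then show ?thesis using s by blast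
qed

text \<open>By \<open>ultrametricI\<close> an archimedean absolute value exceeds 1 at some natural
  number, so on the rationals it is a positive power of the usual one. All archimedean places
  therefore order the rationals alike.\<close>

lemma finite_archimedean_places: "finite {\<nu> \<in> places K. archimedean K \<nu>}"
proof (rule finite_subset[OF _ finite_places_same_order_on_rat[of "\<lambda>c d. \<bar>c\<bar> \<le> \<bar>d\<bar>"]], safe)
  fix \<nu> assume \<nu>: "\<nu> \<in> places K" "archimedean K \<nu>"
  then obtain v x y where v: "v \<in> \<nu>" and xy: "x \<in> K" "y \<in> K" "v (x + y) > max (v x) (v y)"
    unfolding archimedean_def by blast
  have av: "absval v" using place_absval \<nu> v by blast
  then obtain m where "v (of_nat m) > 1"
    using ultrametricI[OF av _ xy(1,2)] xy(3) by (meson not_le)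
  then obtain s where s: "s > 0" "\<And>c. v (of_rat c) = \<bar>of_rat c\<bar> powr s"
    using ostrowski_archimedean[OF av] by blast
  have "v (of_rat c) \<le> v (of_rat d) \<longleftrightarrow> \<bar>c\<bar> \<le> \<bar>d\<bar>" for c d
  proof -
    have abs: "\<bar>of_rat q :: real\<bar> = of_rat \<bar>q\<bar>" for q :: rat
      by (simp add: abs_if of_rat_minus)
    have "v (of_rat c) \<le> v (of_rat d) \<longleftrightarrow> (of_rat \<bar>c\<bar> :: real) \<le> of_rat \<bar>d\<bar>"
      unfolding s(2) abs using s(1) powr_less_mono2[of s "of_rat \<bar>d\<bar>" "of_rat \<bar>c\<bar>"]
        powr_mono2[of s "of_rat \<bar>c\<bar>" "of_rat \<bar>d\<bar>"] by (auto simp: not_le[symmetric])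
    also have "\<dots> \<longleftrightarrow> \<bar>c\<bar> \<le> \<bar>d\<bar>"
      by (rule of_rat_less_eq)
    finally show ?thesis .
  qed
  then show "\<exists>v\<in>\<nu>. \<forall>c d. v (of_rat c) \<le> v (of_rat d) \<longleftrightarrow> \<bar>c\<bar> \<le> \<bar>d\<bar>"
    using v by blast
qed

section \<open>Nonarchimedean places and integrality\<close>

definition ultrametric :: "(complex \<Rightarrow> real) \<Rightarrow> bool" where
  "ultrametric v \<longleftrightarrow> absval v \<and> (\<forall>x\<in>K. \<forall>y\<in>K. v (x + y) \<le> max (v x) (v y))"

lemma ultrametric_place: "\<nu> \<in> places K \<Longrightarrow> \<not> archimedean K \<nu> \<Longrightarrow> v \<in> \<nu> \<Longrightarrow> ultrametric v"
  unfolding ultrametric_def archimedean_def using place_absval by (meson not_le)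

lemma ultrametric_absval: "ultrametric v \<Longrightarrow> absval v"
  by (simp add: ultrametric_def)

lemma ultrametric_add_le: "ultrametric v \<Longrightarrow> x \<in> K \<Longrightarrow> y \<in> K \<Longrightarrow> v x \<le> c \<Longrightarrow> v y \<le> c \<Longrightarrow> v (x + y) \<le> c"
  unfolding ultrametric_def by (meson max.boundedI order_trans)

lemma ultrametric_add_less: "ultrametric v \<Longrightarrow> x \<in> K \<Longrightarrow> y \<in> K \<Longrightarrow> v x < c \<Longrightarrow> v y < c \<Longrightarrow> v (x + y) < c"
  unfolding ultrametric_def by (meson max_less_iff_conj order_le_less_trans)

lemma ultrametric_sum_le:
  assumes "ultrametric v" "c \<ge> 0"
  shows "(\<And>i. i \<in> A \<Longrightarrow> f i \<in> K \<and> v (f i) \<le> c) \<Longrightarrow> v (sum f A) \<le> c"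
proof (induction A rule: infinite_finite_induct)
  case (insert a A)
  then show ?case by (simp add: sum_mem ultrametric_add_le[OF assms(1)])
qed (use assms ultrametric_absval in auto)

lemma ultrametric_of_nat:
  assumes v: "ultrametric v"
  shows "v (of_nat n) \<le> 1"
  by (induction n) (simp_all add: ultrametric_add_le[OF v] ultrametric_absval[OF v])

lemma ultrametric_of_int: "ultrametric v \<Longrightarrow> v (of_int n) \<le> 1"
  using ultrametric_of_nat[of v] ultrametric_absval[of v] by (cases n) (auto simp del: of_nat_Suc)

text \<open>The cofactor left after removing the power of \<open>p\<close> is coprime to
  \<open>p\<close>. If it also had value below 1, a Bezout combination would give
  \<open>v 1 < 1\<close>.\<close>

lemma ultrametric_of_int_eq:
  assumes v: "ultrametric v" and p: "prime p" "v (of_int p) < 1" and n: "n \<noteq> 0"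
  shows "v (of_int n) = v (of_int p) ^ multiplicity p n"
proof -
  note av = ultrametric_absval[OF v]
  obtain n' where n': "n = p ^ multiplicity p n * n'" "\<not> p dvd n'"
  proof (rule multiplicity_decompose'[of n p])
    show "\<not> is_unit p" using p not_prime_unit by blast
  qed (use n in auto)
  have "\<not> v (of_int n') < 1"
  proof
    assume less: "v (of_int n') < 1"
    have "coprime p n'" using p n' by (simp add: prime_imp_coprime)
    then obtain a b where ab: "a * p + b * n' = 1"
      using bezout_int[of p n'] by (auto simp: coprime_iff_gcd_eq_1)
    have prod: "v (of_int (c * m)) < 1" if "v (of_int m) < 1" for c m
    proof -
      have "v (of_int c) * v (of_int m) \<le> 1 * v (of_int m)"
        using av ultrametric_of_int[OF v] by (intro mult_right_mono) auto
      then show ?thesis using that av by (simp add: av_mult)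
    qed
    have "v (of_int (a * p) + of_int (b * n')) < 1"
      using prod[OF p(2)] prod[OF less] by (intro ultrametric_add_less[OF v]) simp_all
    then have "v (of_int (a * p + b * n')) < 1" by (simp only: of_int_add)
    then show False using ab av by simp
  qed
  then have "v (of_int n') = 1"
    using ultrametric_of_int[OF v, of n'] by linarith
  then show ?thesis
    using av arg_cong[OF n'(1), of "\<lambda>k. v (of_int k)"] by (simp add: av_mult av_power)
qed

lemma finite_places_over_prime:
  assumes p: "prime (p :: int)"
  shows "finite {\<nu> \<in> places K. \<not> archimedean K \<nu> \<and> (\<exists>v\<in>\<nu>. v (of_int p) < 1)}"
proof -
  \<comment> \<open>The p-adic valuation of a nonzero rational; larger \<open>k\<close> means
    smaller value. Zero is treated apart in \<open>R\<close>, because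
    \<open>multiplicity p 0 = 0\<close> would give it valuation 0.\<close>
  define k where "k c = int (multiplicity p (fst (quotient_of c))) - int (multiplicity p (snd (quotient_of c)))" for c
  define R where "R c d \<longleftrightarrow> c = 0 \<or> d \<noteq> 0 \<and> k c \<ge> k d" for c d
  show ?thesis
  proof (rule finite_subset[OF _ finite_places_same_order_on_rat[of R]], safe)
    fix \<nu> v assume \<nu>: "\<nu> \<in> places K" "\<not> archimedean K \<nu>" and v: "v \<in> \<nu>" and less: "v (of_int p) < 1"
    have u: "ultrametric v" by (rule ultrametric_place[OF \<nu> v])
    note av = ultrametric_absval[OF u]
    have "p \<noteq> 0" using p by auto
    then have pos: "v (of_int p) > 0" using av by simp
    have val: "v (of_rat c) = v (of_int p) powi k c" if c: "c \<noteq> 0" for c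
    proof -
      obtain a b where ab: "quotient_of c = (a, b)" by force
      have b: "b > 0" using quotient_of_denom_pos[OF ab] .
      have cab: "c = of_int a / of_int b" by (rule quotient_of_div[OF ab])
      have a: "a \<noteq> 0" using c cab by auto
      have "v (of_rat c) = v (of_int a) / v (of_int b)"
        unfolding cab of_rat_divide of_rat_of_int_eq using av by (simp add: av_divide)
      also have "\<dots> = v (of_int p) ^ multiplicity p a / v (of_int p) ^ multiplicity p b"
        using ultrametric_of_int_eq[OF u p less] a b by simp
      also have "\<dots> = v (of_int p) powi k c"
        using pos by (simp add: k_def ab power_int_diff)
      finally show ?thesis .
    qed
    have "v (of_rat c) \<le> v (of_rat d) \<longleftrightarrow> R c d" for c d
    proof (cases "c = 0 \<or> d = 0")
      case True
      moreover have "v (of_rat d) \<ge> 0" "v (of_rat c) \<le> 0 \<longleftrightarrow> c = 0"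
        using av_nonneg[OF av of_rat_mem] av_pos[OF av of_rat_mem[of c]] av_eq_0[OF av of_rat_mem[of c]]
        by (auto simp: not_less[symmetric])
      ultimately show ?thesis using av by (auto simp: R_def)
    next
      case False
      have "v (of_int p) powi k c \<le> v (of_int p) powi k d \<longleftrightarrow> k d \<le> k c"
        using pos less by (metis linorder_not_le power_int_decreasing power_int_strict_decreasing less_irrefl order.strict_implies_order)
      then show ?thesis using False val by (simp add: R_def)
    qed
    then show "\<exists>v\<in>\<nu>. \<forall>c d. v (of_rat c) \<le> v (of_rat d) \<longleftrightarrow> R c d" using v by blast
  qed
qed

lemma algebraic_over_rat:
  assumes x: "x \<in> K"
  obtains n :: nat and u :: "nat \<Rightarrow> rat" where "\<exists>i\<le>n. u i \<noteq> 0" "(\<Sum>i\<le>n. of_rat (u i) * x ^ i) = 0"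
proof -
  obtain B where B: "finite B" "K = rat_vs.span B"
    using num_field unfolding number_field_iff_span by blast
  define n where "n = card B"
  show ?thesis
  proof (cases "inj_on (\<lambda>i. x ^ i) {..n}")
    case True
    have "rat_vs.dependent ((\<lambda>i. x ^ i) ` {..n})"
    proof (rule ccontr)
      assume "\<not> ?thesis"
      moreover have "(\<lambda>i. x ^ i) ` {..n} \<subseteq> rat_vs.span B" unfolding B(2)[symmetric] using x by auto
      ultimately have "card ((\<lambda>i. x ^ i) ` {..n}) \<le> card B"
        using rat_vs.independent_span_bound[OF B(1)] by blast
      then show False using True by (simp add: card_image n_def)
    qed
    then obtain c where "\<exists>y\<in>(\<lambda>i. x ^ i) ` {..n}. c y \<noteq> 0" "(\<Sum>y\<in>(\<lambda>i. x ^ i) ` {..n}. of_rat (c y) * y) = 0"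
      using rat_vs.dependent_finite[of "(\<lambda>i. x ^ i) ` {..n}"] by auto
    then show ?thesis
      by (intro that[of n "\<lambda>i. c (x ^ i)"]) (auto simp: sum.reindex[OF True])
  next
    case False
    then obtain i j where ij: "i \<le> n" "j \<le> n" "i \<noteq> j" "x ^ i = x ^ j"
      by (auto simp: inj_on_def)
    \<comment> \<open>When two powers coincide, the set of powers is too small for the dimension
      count, but the difference of these two is already a relation.\<close>
    define u :: "nat \<Rightarrow> rat" where "u k = (if k = i then 1 else 0) - (if k = j then 1 else 0)" for k
    have "(\<Sum>k\<le>n. of_rat (u k) * x ^ k) = (\<Sum>k\<le>n. (if k = i then x ^ k else 0)) - (\<Sum>k\<le>n. (if k = j then x ^ k else 0))"
      unfolding sum_subtractf[symmetric] by (intro sum.cong) (auto simp: u_def of_rat_diff)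
    also have "\<dots> = 0" using ij by simp
    finally show ?thesis
      using ij by (intro that[of n u]) (auto simp: u_def intro!: exI[of _ i])
  qed
qed

text \<open>If every nonzero coefficient of a polynomial relation for \<open>x\<close> is a unit at
  \<open>v\<close>, then \<open>v x > 1\<close> would let the top term strictly dominate. So
  \<open>x\<close> can fail to be integral only over primes dividing a numerator or denominator of a
  coefficient, and each prime has finitely many places above it.\<close>

lemma finite_nonintegral_places:
  assumes x: "x \<in> K"
  shows "finite {\<nu> \<in> places K. \<not> archimedean K \<nu> \<and> (\<exists>v\<in>\<nu>. v x > 1)}"
proof -
  obtain n u where u: "\<exists>i\<le>n. u i \<noteq> 0" "(\<Sum>i\<le>n. of_rat (u i) * x ^ i) = 0"
    using algebraic_over_rat[OF x] by metis
  \<comment> \<open>All numerators and denominators are multiplied together, so that value 1 at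
    \<open>N\<close> forces value 1 at each of them.\<close>
  define N where "N = (\<Prod>i\<in>{i. i \<le> n \<and> u i \<noteq> 0}. fst (quotient_of (u i)) * snd (quotient_of (u i)))"
  have nz: "fst (quotient_of c) \<noteq> 0" if "c \<noteq> 0" for c
    using quotient_of_div[of c "fst (quotient_of c)" "snd (quotient_of c)"] that by auto
  moreover have "snd (quotient_of c) \<noteq> 0" for c
    using quotient_of_denom_pos'[of c] by simp
  ultimately have N0: "N \<noteq> 0"
    unfolding N_def by auto
  have unit: "v (of_rat (u i)) = 1" if v: "ultrametric v" and N: "v (of_int N) = 1" and i: "i \<le> n" "u i \<noteq> 0" for v i
  proof -
    note av = ultrametric_absval[OF v]
    define a b where "a = fst (quotient_of (u i))" and "b = snd (quotient_of (u i))"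
    have one: "v (of_int m) = 1" if "m dvd N" for m
    proof -
      obtain c where "N = m * c" using \<open>m dvd N\<close> by (elim dvdE)
      then have "v (of_int m) * v (of_int c) = 1" using N av by (simp add: av_mult)
      moreover have "v (of_int m) * v (of_int c) \<le> v (of_int m) * 1"
        using av ultrametric_of_int[OF v] by (intro mult_left_mono) auto
      ultimately show ?thesis using ultrametric_of_int[OF v, of m] by simp
    qed
    have "a * b dvd N"
      unfolding N_def a_def b_def using i by (intro dvd_prodI) auto
    then have "v (of_int a) = 1" "v (of_int b) = 1"
      by (auto intro!: one dest: dvd_mult_left dvd_mult_right)
    moreover have "u i = of_int a / of_int b"
      by (rule quotient_of_div) (simp add: a_def b_def)
    ultimately show ?thesis using av by (simp add: of_rat_divide av_divide)
  qed
  have bad: "v (of_int N) < 1" if v: "ultrametric v" and gt: "v x > 1" for v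
  proof (rule ccontr)
    note av = ultrametric_absval[OF v]
    assume "\<not> ?thesis"
    then have N1: "v (of_int N) = 1" using ultrametric_of_int[OF v, of N] by linarith
    define m where "m = Max {i. i \<le> n \<and> u i \<noteq> 0}"
    have fin: "finite {i. i \<le> n \<and> u i \<noteq> 0}" by simp
    have "m \<in> {i. i \<le> n \<and> u i \<noteq> 0}"
      unfolding m_def using u(1) by (intro Max_in fin) auto
    then have m: "m \<le> n" "u m \<noteq> 0" by auto
    have zero: "u i = 0" if "i > m" "i \<le> n" for i
      using Max_ge[OF fin, of i] that unfolding m_def by fastforce
    have "(\<Sum>i\<le>n. of_rat (u i) * x ^ i) = (\<Sum>i\<in>{..m}. of_rat (u i) * x ^ i)"
      using m zero by (intro sum.mono_neutral_right) (auto simp: not_le)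
    also have "\<dots> = (\<Sum>i<m. of_rat (u i) * x ^ i) + of_rat (u m) * x ^ m"
      by (simp add: lessThan_Suc_atMost[symmetric])
    finally have eq: "of_rat (u m) * x ^ m = - (\<Sum>i<m. of_rat (u i) * x ^ i)"
      using u(2) by (simp add: add_eq_0_iff)
    have sumK: "(\<Sum>i<m. of_rat (u i) * x ^ i) \<in> K" using x by (intro sum_mem) auto
    have "v x ^ m = v (of_rat (u m) * x ^ m)"
      using unit[OF v N1 m] av x by (simp add: av_mult av_power)
    also have "\<dots> = v (\<Sum>i<m. of_rat (u i) * x ^ i)"
      unfolding eq by (rule av_minus[OF av sumK])
    \<comment> \<open>Every lower term is smaller than the top one by at least a factor
      \<open>v x\<close>.\<close>
    also have "\<dots> \<le> v x ^ m / v x"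
    proof (rule ultrametric_sum_le[OF v])
      fix i assume "i \<in> {..<m}"
      then have i: "i \<le> n" "Suc i \<le> m" using m by auto
      have "v x ^ Suc i \<le> v x ^ m" using i gt by (intro power_increasing) auto
      then have "v x ^ i \<le> v x ^ m / v x" using gt by (simp add: field_simps)
      moreover have "v x ^ m / v x \<ge> 0" using gt by simp
      ultimately show "of_rat (u i) * x ^ i \<in> K \<and> v (of_rat (u i) * x ^ i) \<le> v x ^ m / v x"
        using unit[OF v N1 i(1)] av x by (cases "u i = 0") (auto simp: av_mult av_power)
    qed (use gt in simp)
    finally have "v x ^ m \<le> v x ^ m / v x" .
    moreover have "v x ^ m > 0" using gt by simp
    ultimately show False using gt by (simp add: field_simps)
  qed
  have "{\<nu> \<in> places K. \<not> archimedean K \<nu> \<and> (\<exists>v\<in>\<nu>. v x > 1)} \<subseteq>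
      (\<Union>p\<in>prime_factors N. {\<nu> \<in> places K. \<not> archimedean K \<nu> \<and> (\<exists>v\<in>\<nu>. v (of_int p) < 1)})"
  proof safe
    fix \<nu> v assume \<nu>: "\<nu> \<in> places K" "\<not> archimedean K \<nu>" "v \<in> \<nu>" "v x > 1"
    have v: "ultrametric v" by (rule ultrametric_place[OF \<nu>(1-3)])
    note av = ultrametric_absval[OF v]
    have "\<exists>p\<in>prime_factors N. v (of_int p) < 1"
    proof (rule ccontr)
      assume "\<not> ?thesis"
      then have "v (of_int p) = 1" if "p \<in> prime_factors N" for p
        using that ultrametric_of_int[OF v, of p] by (meson antisym not_less)
      moreover have "v (of_int (\<Prod>p\<in>A. p ^ f p)) = (\<Prod>p\<in>A. v (of_int p) ^ f p)" for A f
        using av by (simp add: av_prod av_power)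
      ultimately have "v (of_int (\<Prod>p\<in>prime_factors N. p ^ multiplicity p N)) = 1"
        by simp
      then have "v (of_int \<bar>N\<bar>) = 1"
        by (simp add: prod_prime_factors N0)
      then have "v (of_int N) = 1" using av by (simp add: abs_if split: if_splits)
      then show False using bad[OF v \<nu>(4)] by simp
    qed
    then show "\<nu> \<in> (\<Union>p\<in>prime_factors N. {\<nu> \<in> places K. \<not> archimedean K \<nu> \<and> (\<exists>v\<in>\<nu>. v (of_int p) < 1)})"
      using \<nu> by blast
  qed
  moreover have "finite (\<Union>p\<in>prime_factors N. {\<nu> \<in> places K. \<not> archimedean K \<nu> \<and> (\<exists>v\<in>\<nu>. v (of_int p) < 1)})"
    by (intro finite_UN_I finite_places_over_prime) auto
  ultimately show ?thesis by (rule finite_subset)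
qed

end

section \<open>Quadratic extensions\<close>

text \<open>If \<open>s\<close> is not in \<open>K\<close>, the sum of \<open>K\<close> and its
  multiple by \<open>s\<close> works: it is closed under products because \<open>s * s\<close>
  reduces to \<open>\<beta> * s + \<gamma>\<close>, and under inverses by conjugation. A degenerate
  equation with \<open>a = 0\<close> already puts \<open>s\<close> into \<open>K\<close>.\<close>

lemma number_field_adjoin_quadratic:
  assumes K: "number_field K" and abc: "a \<in> K" "b \<in> K" "c \<in> K" "a \<noteq> 0 \<or> b \<noteq> 0 \<or> c \<noteq> 0"
    and root: "a * s\<^sup>2 + b * s + c = 0"
  shows "\<exists>L. number_field L \<and> K \<subseteq> L \<and> s \<in> L"
proof (cases "s \<in> K")
  case False
  interpret num_field K by unfold_locales (rule K)
  have "a \<noteq> 0"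
  proof
    assume "a = 0"
    moreover from this root abc have "b \<noteq> 0" by auto
    ultimately have "s = - c / b" using root by (simp add: field_simps eq_neg_iff_add_eq_0)
    then show False using False abc by simp
  qed
  define \<beta> \<gamma> where "\<beta> = - b / a" and "\<gamma> = - c / a"
  have \<beta>\<gamma>: "\<beta> \<in> K" "\<gamma> \<in> K" using abc by (simp_all add: \<beta>_def \<gamma>_def)
  have s2: "s * s = \<beta> * s + \<gamma>"
    using root \<open>a \<noteq> 0\<close> by (simp add: \<beta>_def \<gamma>_def field_simps power2_eq_square) algebra
  define L where "L = {x + y * s |x y. x \<in> K \<and> y \<in> K}"
  have LI: "x + y * s \<in> L" if "x \<in> K" "y \<in> K" for x y using that by (auto simp: L_def)
  have "number_field L"
    unfolding number_field_iff_span
  proof (intro conjI ballI)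
    show "1 \<in> L" using LI[of 1 0] by simp
    fix z w assume "z \<in> L" "w \<in> L"
    then obtain x y x' y' where xy: "x \<in> K" "y \<in> K" "x' \<in> K" "y' \<in> K" "z = x + y * s" "w = x' + y' * s"
      by (auto simp: L_def)
    have "z - w = (x - x') + (y - y') * s" by (simp add: xy algebra_simps)
    then show "z - w \<in> L" using LI[of "x - x'" "y - y'"] xy(1-4) by simp
    have "z * w = x * x' + (x * y' + x' * y) * s + y * y' * (s * s)" by (simp add: xy algebra_simps)
    also have "\<dots> = (x * x' + y * y' * \<gamma>) + (x * y' + x' * y + y * y' * \<beta>) * s"
      unfolding s2 by (simp add: algebra_simps)
    finally show "z * w \<in> L"
      using LI[of "x * x' + y * y' * \<gamma>" "x * y' + x' * y + y * y' * \<beta>"] xy(1-4) \<beta>\<gamma> by simp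
  next
    fix z assume "z \<in> L"
    then obtain x y where xy: "x \<in> K" "y \<in> K" "z = x + y * s"
      by (auto simp: L_def)
    \<comment> \<open>This is the norm of \<open>z\<close>: the other root is
      \<open>\<beta> - s\<close>, so \<open>x + y * \<beta> - y * s\<close> is the conjugate. For
      \<open>z \<noteq> 0\<close> the conjugate is nonzero because \<open>s\<close> is not in
      \<open>K\<close>.\<close>
    define n where "n = x * x + x * y * \<beta> - y * y * \<gamma>"
    have n: "n \<in> K" using xy \<beta>\<gamma> by (simp add: n_def)
    have zn: "z * ((x + y * \<beta>) - y * s) = n"
    proof -
      have "z * ((x + y * \<beta>) - y * s) = x * x + x * y * \<beta> + y * y * (\<beta> * s) - y * y * (s * s)"
        by (simp add: xy algebra_simps)
      then show ?thesis unfolding s2 n_def by (simp add: algebra_simps)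
    qed
    show "inverse z \<in> L"
    proof (cases "z = 0")
      case True
      then show ?thesis using LI[of 0 0] by simp
    next
      case z: False
      have "(x + y * \<beta>) - y * s \<noteq> 0"
      proof
        assume eq: "(x + y * \<beta>) - y * s = 0"
        show False
        proof (cases "y = 0")
          case True
          then show False using eq z xy by simp
        next
          case y: False
          then have "s = (x + y * \<beta>) / y" using eq by (simp add: field_simps)
          then show False using False xy \<beta>\<gamma> by simp
        qed
      qed
      then have "n \<noteq> 0" using z zn by auto
      then have "inverse z = ((x + y * \<beta>) - y * s) / n"
        using z zn by (simp add: field_simps)
      also have "\<dots> = (x + y * \<beta>) / n + (- y / n) * s" by (simp add: diff_divide_distrib)
      finally show ?thesis using LI[of "(x + y * \<beta>) / n" "- y / n"] xy \<beta>\<gamma> n by simp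
    qed
  next
    obtain B where B: "finite B" "K = rat_vs.span B"
      using K unfolding number_field_iff_span by blast
    \<comment> \<open>Multiplication by \<open>s\<close> is linear over the rationals, so it maps
      the span of \<open>B\<close> onto the span of the image of \<open>B\<close>.\<close>
    have "module_hom (\<lambda>(q::rat) (x::complex). of_rat q * x) (\<lambda>q x. of_rat q * x) (\<lambda>x. x * s)"
      by unfold_locales (auto simp: algebra_simps)
    then have "rat_vs.span ((\<lambda>x. x * s) ` B) = (\<lambda>x. x * s) ` K"
      unfolding B(2) by (rule module_hom.span_image)
    then have "L = rat_vs.span (B \<union> (\<lambda>x. x * s) ` B)"
      unfolding rat_vs.span_Un by (auto simp: L_def simp flip: B(2))
    then show "\<exists>B. finite B \<and> L = rat_vs.span B"
      using B(1) by (intro exI[of _ "B \<union> (\<lambda>x. x * s) ` B"]) simp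
  qed
  moreover have "K \<subseteq> L" using LI[of _ 0] by auto
  moreover have "s \<in> L" using LI[of 0 1] by simp
  ultimately show ?thesis by blast
qed (use K in auto)


section \<open>Forms and projective points\<close>

definition eval_monom :: "('n::finite \<Rightarrow>\<^sub>0 nat) \<Rightarrow> complex ^ 'n \<Rightarrow> complex" where
  "eval_monom m x = (\<Prod>i\<in>UNIV. (x $ i) ^ Poly_Mapping.lookup m i)"

lemma eval_poly_superset:
  assumes "finite S" "Poly_Mapping.keys f \<subseteq> S"
  shows "eval_poly f x = (\<Sum>m\<in>S. Poly_Mapping.lookup f m * eval_monom m x)"
  unfolding eval_poly_def eval_monom_def using assms
  by (intro sum.mono_neutral_left) (auto simp: in_keys_iff)

lemma eval_poly_add: "eval_poly (f + g) x = eval_poly f x + eval_poly g x"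
proof -
  let ?S = "Poly_Mapping.keys f \<union> Poly_Mapping.keys g"
  have "Poly_Mapping.keys (f + g) \<subseteq> ?S" by (rule Poly_Mapping.keys_add)
  then show ?thesis
    by (simp add: eval_poly_superset[of ?S] lookup_add sum.distrib algebra_simps)
qed

lemma eval_poly_sum: "eval_poly (sum F A) x = (\<Sum>a\<in>A. eval_poly (F a) x)"
proof (induction A rule: infinite_finite_induct)
  case (insert a A)
  then show ?case by (simp add: eval_poly_add)
qed (simp_all add: eval_poly_def)

lemma eval_poly_single: "eval_poly (Poly_Mapping.single m c) x = c * eval_monom m x"
  by (cases "c = 0") (simp_all add: eval_poly_def eval_monom_def)

lemma eval_monom_add: "eval_monom (m + n) x = eval_monom m x * eval_monom n x"
  by (simp add: eval_monom_def lookup_add power_add prod.distrib)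

lemma poly_mapping_mult_eq:
  fixes f g :: "'n::finite polynomial"
  shows "f * g = (\<Sum>m\<in>Poly_Mapping.keys f. \<Sum>n\<in>Poly_Mapping.keys g.
    Poly_Mapping.single (m + n) (Poly_Mapping.lookup f m * Poly_Mapping.lookup g n))"
proof -
  have *: "(\<Sum>m\<in>Poly_Mapping.keys h. Poly_Mapping.single m (Poly_Mapping.lookup h m)) = h" for h :: "'n polynomial"
    by (rule poly_mapping_eqI)
      (auto simp: lookup_sum lookup_single when_def in_keys_iff)
  have "f * g = (\<Sum>m\<in>Poly_Mapping.keys f. Poly_Mapping.single m (Poly_Mapping.lookup f m)) *
      (\<Sum>n\<in>Poly_Mapping.keys g. Poly_Mapping.single n (Poly_Mapping.lookup g n))"
    by (simp only: *)
  then show ?thesis by (simp only: sum_product mult_single)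
qed

lemma eval_poly_mult: "eval_poly (f * g) x = eval_poly f x * eval_poly g x"
proof -
  have "eval_poly (f * g) x = (\<Sum>m\<in>Poly_Mapping.keys f. \<Sum>n\<in>Poly_Mapping.keys g.
      (Poly_Mapping.lookup f m * eval_monom m x) * (Poly_Mapping.lookup g n * eval_monom n x))"
    unfolding poly_mapping_mult_eq[of f g] eval_poly_sum eval_poly_single eval_monom_add
    by (intro sum.cong refl) (simp add: mult_ac)
  then show ?thesis
    by (simp add: sum_product eval_poly_superset[of "Poly_Mapping.keys f" f] eval_poly_superset[of "Poly_Mapping.keys g" g])
qed

text \<open>One closure notion serves both coefficient domains, number fields and valuation rings,
  so rationality and integrality of values of forms share their lemmas. Where a subtraction occurs,
  \<open>- 1 \<in> R\<close> is assumed in addition.\<close>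

definition semiring_set :: "complex set \<Rightarrow> bool" where
  "semiring_set R \<longleftrightarrow> 0 \<in> R \<and> 1 \<in> R \<and> (\<forall>x\<in>R. \<forall>y\<in>R. x + y \<in> R \<and> x * y \<in> R)"

lemma semiring_set_sum: "semiring_set R \<Longrightarrow> (\<And>i. i \<in> A \<Longrightarrow> f i \<in> R) \<Longrightarrow> sum f A \<in> R"
  by (induction A rule: infinite_finite_induct) (auto simp: semiring_set_def)

lemma semiring_set_prod: "semiring_set R \<Longrightarrow> (\<And>i. i \<in> A \<Longrightarrow> f i \<in> R) \<Longrightarrow> prod f A \<in> R"
  by (induction A rule: infinite_finite_induct) (auto simp: semiring_set_def)

lemma semiring_set_power: "semiring_set R \<Longrightarrow> x \<in> R \<Longrightarrow> x ^ n \<in> R"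
  by (induction n) (auto simp: semiring_set_def)

lemma semiring_set_mult: "semiring_set R \<Longrightarrow> x \<in> R \<Longrightarrow> y \<in> R \<Longrightarrow> x * y \<in> R"
  and semiring_set_add: "semiring_set R \<Longrightarrow> x \<in> R \<Longrightarrow> y \<in> R \<Longrightarrow> x + y \<in> R"
  by (auto simp: semiring_set_def)

lemma eval_form_mem:
  assumes R: "semiring_set R" and f: "is_form R d f" and x: "\<And>i. x $ i \<in> R"
  shows "eval_poly f x \<in> R"
  unfolding eval_poly_def using f x
  by (intro semiring_set_sum semiring_set_mult semiring_set_prod semiring_set_power R)
    (auto simp: is_form_def)

lemma is_form_mult:
  assumes R: "semiring_set R" and f: "is_form R d f" and g: "is_form R e g"
  shows "is_form R (d + e) (f * g)"
  unfolding is_form_def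
proof (intro ballI conjI)
  fix k assume "k \<in> Poly_Mapping.keys (f * g)"
  then obtain m n where "m \<in> Poly_Mapping.keys f" "n \<in> Poly_Mapping.keys g" "k = m + n"
    using keys_mult[of f g] by blast
  then show "(\<Sum>i\<in>UNIV. Poly_Mapping.lookup k i) = d + e"
    using f g by (simp add: is_form_def lookup_add sum.distrib)
  show "Poly_Mapping.lookup (f * g) k \<in> R"
    unfolding poly_mapping_mult_eq[of f g] lookup_sum
  proof (intro semiring_set_sum R)
    fix m n assume "m \<in> Poly_Mapping.keys f" "n \<in> Poly_Mapping.keys g"
    then show "Poly_Mapping.lookup (Poly_Mapping.single (m + n)
        (Poly_Mapping.lookup f m * Poly_Mapping.lookup g n)) k \<in> R"
      using f g R by (auto simp: lookup_single when_def is_form_def semiring_set_def)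
  qed
qed

lemma is_form_mono: "is_form R d f \<Longrightarrow> R \<subseteq> R' \<Longrightarrow> is_form R' d f"
  by (auto simp: is_form_def)

lemma eval_form_scale:
  assumes "is_form R d f"
  shows "eval_poly f (c *s x) = c ^ d * eval_poly f x"
proof -
  have "eval_monom m (c *s x) = c ^ d * eval_monom m x" if "m \<in> Poly_Mapping.keys f" for m
  proof -
    have "(\<Sum>i\<in>UNIV. Poly_Mapping.lookup m i) = d" using assms that by (simp add: is_form_def)
    then show ?thesis
      by (simp add: eval_monom_def power_mult_distrib prod.distrib flip: power_sum)
  qed
  then show ?thesis
    by (simp add: eval_poly_superset[of "Poly_Mapping.keys f" f] sum_distrib_left mult_ac)
qed

lemma eval_poly_on_line: "\<exists>p. \<forall>t. eval_poly f (a + t *s b) = poly p t"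
proof (intro exI allI)
  fix t
  show "eval_poly f (a + t *s b) = poly (\<Sum>m\<in>Poly_Mapping.keys f. [:Poly_Mapping.lookup f m:] *
      (\<Prod>i\<in>UNIV. [:a $ i, b $ i:] ^ Poly_Mapping.lookup m i)) t"
    by (simp add: eval_poly_def poly_sum poly_prod mult.commute)
qed

text \<open>On a line the polynomial becomes univariate and has finitely many roots unless it is
  zero. In the density argument this frees one coordinate at a time from an infinite set of
  values.\<close>

lemma eval_poly_zero_on_line:
  assumes "infinite T" and T: "\<And>t. t \<in> T \<Longrightarrow> eval_poly f (a + t *s b) = 0"
  shows "eval_poly f (a + t *s b) = 0"
proof -
  obtain p where p: "\<And>t. eval_poly f (a + t *s b) = poly p t"
    using eval_poly_on_line by blast
  have "T \<subseteq> {t. poly p t = 0}" using T p by auto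
  then have "infinite {t. poly p t = 0}" using assms(1) finite_subset by blast
  then have "p = 0" using poly_roots_finite by blast
  then show ?thesis using p by simp
qed

section \<open>Linear and quadratic forms\<close>

lemma sum_eq_1_imp_single:
  assumes "(\<Sum>i\<in>UNIV. Poly_Mapping.lookup m i) = (1::nat)"
  shows "\<exists>i::'n::finite. m = Poly_Mapping.single i 1"
proof -
  have "\<exists>i. Poly_Mapping.lookup m i = 1 \<and> (\<forall>j. i \<noteq> j \<longrightarrow> Poly_Mapping.lookup m j = 0)"
    using sum_eq_1_iff[THEN iffD1, OF finite assms] by blast
  then obtain i where i: "Poly_Mapping.lookup m i = 1" "\<And>j. j \<noteq> i \<Longrightarrow> Poly_Mapping.lookup m j = 0"
    by metis
  then have "m = Poly_Mapping.single i 1"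
    by (intro poly_mapping_eqI) (auto simp: lookup_single when_def)
  then show ?thesis ..
qed

lemma sum_eq_2_imp_single:
  assumes "(\<Sum>i\<in>UNIV. Poly_Mapping.lookup m i) = (2::nat)"
  shows "\<exists>i j::'n::finite. m = Poly_Mapping.single i 1 + Poly_Mapping.single j 1"
proof -
  obtain i where i: "Poly_Mapping.lookup m i \<noteq> 0"
    using assms by force
  define n where "n = m - Poly_Mapping.single i 1"
  have m: "m = Poly_Mapping.single i 1 + n"
    using i by (intro poly_mapping_eqI) (auto simp: n_def lookup_add lookup_minus lookup_single when_def)
  have "(\<Sum>j\<in>UNIV. Poly_Mapping.lookup (Poly_Mapping.single i (1::nat)) j) = 1"
    by (simp add: lookup_single when_def)
  then have "(\<Sum>j\<in>UNIV. Poly_Mapping.lookup n j) = 1"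
    using assms unfolding m by (simp add: lookup_add sum.distrib)
  then show ?thesis using sum_eq_1_imp_single m by blast
qed

lemma eval_monom_single: "eval_monom (Poly_Mapping.single i 1) x = x $ i"
proof -
  have "eval_monom (Poly_Mapping.single i 1) x = (\<Prod>j\<in>UNIV. if j = i then x $ j else 1)"
    unfolding eval_monom_def by (intro prod.cong) (auto simp: lookup_single when_def)
  then show ?thesis by simp
qed

lemma linear_form_coeffs:
  fixes l :: "'n::finite polynomial"
  assumes l: "is_form R 1 l" "l \<noteq> 0" and R: "0 \<in> R"
  obtains a :: "complex ^ 'n" where "\<And>i. a $ i \<in> R" "a \<noteq> 0" "\<And>x. eval_poly l x = (\<Sum>i\<in>UNIV. a $ i * x $ i)"
proof
  let ?s = "\<lambda>i::'n. Poly_Mapping.single i (1::nat)"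
  define a :: "complex ^ 'n" where "a = (\<chi> i. Poly_Mapping.lookup l (?s i))"
  have keys: "Poly_Mapping.keys l \<subseteq> range ?s"
    using l sum_eq_1_imp_single by (fastforce simp: is_form_def)
  have inj: "inj ?s"
    using keys_single[of _ "1::nat"] by (metis injI singleton_inject zero_neq_one)
  show "a $ i \<in> R" for i
    using l R by (cases "?s i \<in> Poly_Mapping.keys l") (auto simp: a_def is_form_def in_keys_iff)
  show "a \<noteq> 0"
  proof -
    obtain m where "m \<in> Poly_Mapping.keys l" using l(2) by (metis all_not_in_conv keys_eq_empty)
    then obtain i where "a $ i \<noteq> 0" using keys by (auto simp: a_def in_keys_iff)
    then show ?thesis by auto
  qed
  show "eval_poly l x = (\<Sum>i\<in>UNIV. a $ i * x $ i)" for x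
    using eval_poly_superset[OF _ keys, of x] eval_monom_single[of _ x]
    by (simp add: sum.reindex[OF inj] a_def del: One_nat_def)
qed

text \<open>Each monomial of degree 2 is a product of two coordinates \<open>i\<close> and
  \<open>j\<close>, possibly equal, and contributes \<open>x $ i * y $ j + y $ i * x $ j\<close> to
  \<open>B\<close>. In this normalization \<open>B x x\<close> is twice the value of
  \<open>q\<close> at \<open>x\<close>.\<close>

lemma quadratic_form_polarization:
  fixes q :: "'n::finite polynomial"
  assumes q: "is_form R 2 q"
  obtains B where "\<And>x y. eval_poly q (x + y) = eval_poly q x + eval_poly q y + B x y"
    "\<And>x y z. B (x + y) z = B x z + B y z" "\<And>c x y. B (c *s x) y = c * B x y" "\<And>x y. B x y = B y x"
proof -
  have "\<forall>m\<in>Poly_Mapping.keys q. \<exists>i j. m = Poly_Mapping.single i 1 + Poly_Mapping.single j 1"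
    using q sum_eq_2_imp_single by (auto simp: is_form_def)
  then obtain i j where ij: "\<And>m. m \<in> Poly_Mapping.keys q \<Longrightarrow>
      m = Poly_Mapping.single (i m) 1 + Poly_Mapping.single (j m) 1"
    by metis
  define c where "c m = Poly_Mapping.lookup q m" for m
  define B where "B x y = (\<Sum>m\<in>Poly_Mapping.keys q. c m * (x $ i m * y $ j m + y $ i m * x $ j m))" for x y :: "complex ^ 'n"
  have "eval_monom m x = x $ i m * x $ j m" if "m \<in> Poly_Mapping.keys q" for m x
    using arg_cong[OF ij[OF that], of "\<lambda>m. eval_monom m x"] by (simp add: eval_monom_add eval_monom_single del: One_nat_def)
  then have ev: "eval_poly q x = (\<Sum>m\<in>Poly_Mapping.keys q. c m * (x $ i m * x $ j m))" for x
    by (simp add: eval_poly_superset[of "Poly_Mapping.keys q" q] c_def)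
  show ?thesis
  proof (rule that)
    show "eval_poly q (x + y) = eval_poly q x + eval_poly q y + B x y" for x y
      unfolding ev B_def sum.distrib[symmetric] by (intro sum.cong) (auto simp: algebra_simps)
    show "B (x + y) z = B x z + B y z" for x y z
      unfolding B_def sum.distrib[symmetric] by (intro sum.cong) (auto simp: algebra_simps)
    show "B (c *s x) y = c * B x y" for c x y
      unfolding B_def sum_distrib_left by (intro sum.cong) (auto simp: algebra_simps)
    show "B x y = B y x" for x y
      unfolding B_def by (intro sum.cong) (auto simp: algebra_simps)
  qed
qed

section \<open>Projective points and their coordinate vectors\<close>

definition proj_pt :: "complex ^ 'n \<Rightarrow> 'n::finite proj" where
  "proj_pt x = Abs_proj {c *s x |c. c \<noteq> 0}"

lemma hcoords_proj_pt: "x \<noteq> 0 \<Longrightarrow> hcoords (proj_pt x) = {c *s x |c. c \<noteq> 0}"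
  unfolding proj_pt_def by (rule Abs_proj_inverse) blast

lemma proj_pt_cases: obtains x where "x \<noteq> 0" "P = proj_pt x"
proof -
  obtain x where "x \<noteq> 0" "hcoords P = {c *s x |c. c \<noteq> 0}"
    using hcoords[of P] by auto
  then show ?thesis using that[of x] hcoords_inverse[of P] by (simp add: proj_pt_def)
qed

lemma proj_pt_eqD:
  assumes "x \<noteq> 0" "y \<noteq> 0" "proj_pt x = proj_pt y"
  shows "\<exists>c. c \<noteq> 0 \<and> x = c *s y"
proof -
  have "x \<in> hcoords (proj_pt x)"
    unfolding hcoords_proj_pt[OF assms(1)] by (auto intro!: exI[of _ 1])
  then show ?thesis using assms hcoords_proj_pt[of y] by auto
qed

lemma proj_pt_scale:
  assumes "c \<noteq> 0"
  shows "proj_pt (c *s x) = proj_pt x"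
proof -
  have "{d *s (c *s x) |d. d \<noteq> 0} = {d *s x |d. d \<noteq> 0}"
  proof (intro subset_antisym subsetI)
    fix y assume "y \<in> {d *s x |d. d \<noteq> 0}"
    then obtain d where d: "d \<noteq> 0" "y = d *s x" by blast
    then have "y = (d / c) *s (c *s x)" "d / c \<noteq> 0" using assms by auto
    then show "y \<in> {d *s (c *s x) |d. d \<noteq> 0}" by blast
  qed (use assms in auto)
  then show ?thesis by (simp add: proj_pt_def)
qed

lemma proj_pt_in_zero_locus:
  assumes "is_form R d f" "x \<noteq> 0"
  shows "proj_pt x \<in> zero_locus {f} \<longleftrightarrow> eval_poly f x = 0"
proof -
  have "eval_poly f (1 *s x) = eval_poly f x" by simp
  then show ?thesis
    unfolding zero_locus_def using assms(2)
    by (fastforce simp: hcoords_proj_pt eval_form_scale[OF assms(1)])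
qed


section \<open>Coordinates adapted to the quadric and the planes\<close>

lemma num_field_semiring_set: "number_field L \<Longrightarrow> semiring_set L"
proof -
  assume "number_field L"
  then interpret num_field L by (rule num_field.intro)
  show ?thesis by (simp add: semiring_set_def)
qed

text \<open>Here \<open>p1\<close> and \<open>p2\<close> are coordinate vectors of the two
  intersection points, with complex entries that are not yet in any number field, and
  \<open>B\<close> is the polarization of \<open>q\<close>. The absence of a third point,
  \<open>p_only\<close>, forces the planes to be distinct and their common line not to lie in the
  quadric.\<close>

locale plane_pair =
  fixes K :: "complex set" and l1 l2 q :: "4 polynomial" and a b :: "complex ^ 4"
    and B :: "complex ^ 4 \<Rightarrow> complex ^ 4 \<Rightarrow> complex" and p1 p2 :: "complex ^ 4"
  assumes K: "number_field K"
    and q: "is_form K 2 q"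
    and aK: "\<And>i. a $ i \<in> K" and bK: "\<And>i. b $ i \<in> K" and a0: "a \<noteq> 0" and b0: "b \<noteq> 0"
    and l1_eq: "\<And>x. eval_poly l1 x = (\<Sum>i\<in>UNIV. a $ i * x $ i)"
    and l2_eq: "\<And>x. eval_poly l2 x = (\<Sum>i\<in>UNIV. b $ i * x $ i)"
    and q_add: "\<And>x y. eval_poly q (x + y) = eval_poly q x + eval_poly q y + B x y"
    and B_add: "\<And>x y z. B (x + y) z = B x z + B y z"
    and B_scale: "\<And>c x y. B (c *s x) y = c * B x y"
    and B_sym: "\<And>x y. B x y = B y x"
    and p: "p1 \<noteq> 0" "p2 \<noteq> 0" "eval_poly q p1 = 0" "eval_poly q p2 = 0"
      "eval_poly l1 p1 = 0" "eval_poly l1 p2 = 0" "eval_poly l2 p1 = 0" "eval_poly l2 p2 = 0"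
    and p_neq: "\<And>c. p1 \<noteq> c *s p2" "\<And>c. p2 \<noteq> c *s p1"
    and p_only: "\<And>x. x \<noteq> 0 \<Longrightarrow> eval_poly q x = 0 \<Longrightarrow> eval_poly l1 x = 0 \<Longrightarrow> eval_poly l2 x = 0 \<Longrightarrow>
      \<exists>c. c \<noteq> 0 \<and> (x = c *s p1 \<or> x = c *s p2)"
begin

sublocale num_field K by unfold_locales (rule K)

lemma l1_add: "eval_poly l1 (x + y) = eval_poly l1 x + eval_poly l1 y"
  and l1_scale: "eval_poly l1 (c *s x) = c * eval_poly l1 x"
  by (simp_all add: l1_eq sum.distrib distrib_left sum_distrib_left mult_ac)

lemma l2_add: "eval_poly l2 (x + y) = eval_poly l2 x + eval_poly l2 y"
  and l2_scale: "eval_poly l2 (c *s x) = c * eval_poly l2 x"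
  by (simp_all add: l2_eq sum.distrib distrib_left sum_distrib_left mult_ac)

lemma q_scale: "eval_poly q (c *s x) = c\<^sup>2 * eval_poly q x"
  by (rule eval_form_scale[OF q])

lemma B_add2: "B z (x + y) = B z x + B z y"
  and B_scale2: "B y (c *s x) = c * B y x"
  using B_add[of x y z] B_scale[of c x y] B_sym by metis+

lemma B_self: "B x x = 2 * eval_poly q x"
proof -
  have "x + x = 2 *s x" by (simp add: vec_eq_iff)
  then have "4 * eval_poly q x = 2 * eval_poly q x + B x x"
    using q_add[of x x] q_scale[of 2 x] by simp
  then show ?thesis by simp
qed

lemmas bilin = l1_add l1_scale l2_add l2_scale q_add q_scale B_add B_scale B_add2 B_scale2

text \<open>If \<open>B x y\<close> vanished, \<open>q\<close> would vanish on the whole line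
  through \<open>x\<close> and \<open>y\<close>, and \<open>x + y\<close> would be a third
  intersection point.\<close>

lemma isotropic_pair:
  assumes "eval_poly q x = 0" "eval_poly l1 x = 0" "eval_poly l2 x = 0"
    and "eval_poly q y = 0" "eval_poly l1 y = 0" "eval_poly l2 y = 0"
    and "x \<noteq> 0" "y \<noteq> 0" "\<And>c. x \<noteq> c *s y" "\<And>c. y \<noteq> c *s x"
  shows "B x y \<noteq> 0"
proof
  assume B0: "B x y = 0"
  have "x + y \<noteq> 0" using assms(9)[of "-1"] by (auto simp: add_eq_0_iff2)
  moreover have "eval_poly q (x + y) = 0" "eval_poly l1 (x + y) = 0" "eval_poly l2 (x + y) = 0"
    using assms B0 by (simp_all add: bilin)
  ultimately obtain c where c: "c \<noteq> 0" "x + y = c *s p1 \<or> x + y = c *s p2"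
    using p_only by blast
  obtain d where d: "d \<noteq> 0" "x = d *s p1 \<or> x = d *s p2"
    using p_only assms by blast
  obtain e where e: "e \<noteq> 0" "y = e *s p1 \<or> y = e *s p2"
    using p_only assms by blast
  have np: False if "u = r *s w" "v = s *s w" "r \<noteq> 0" "\<And>c. v \<noteq> c *s u" for u v w :: "complex ^ 4" and r s
  proof -
    have "v = (s / r) *s u" using that(1,2,3) by simp
    then show False using that(4) by blast
  qed
  \<comment> \<open>Pigeonhole: the three vectors \<open>x\<close>, \<open>y\<close>,
    \<open>x + y\<close> are multiples of only two vectors, so two of them are proportional.\<close>
  consider r where "x + y = r *s x" | r where "x + y = r *s y" | r where "x = r *s y"
  proof -
    have "x + y = (c / d) *s x \<or> x + y = (c / e) *s y \<or> x = (d / e) *s y"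
      using c d e by auto
    then show thesis using that by blast
  qed
  then show False
  proof cases
    case 1
    then have "y = (r - 1) *s x" by (simp add: vec.scale_left_diff_distrib algebra_simps)
    then show False using assms by blast
  next
    case 2
    then have "x = (r - 1) *s y" by (simp add: vec.scale_left_diff_distrib algebra_simps)
    then show False using assms by blast
  qed (use assms in blast)
qed

lemma sum_axis: "(\<Sum>i\<in>UNIV. c $ i * (axis j 1 :: complex ^ 4) $ i) = c $ j"
proof -
  have "(\<Sum>i\<in>UNIV. c $ i * (axis j 1 :: complex ^ 4) $ i) = (\<Sum>i\<in>UNIV. if i = j then c $ i else 0)"
    by (intro sum.cong) (auto simp: axis_def)
  then show ?thesis by simp
qed

text \<open>If all minors vanished, the planes would coincide, and the conic cut out by the quadric on
  this plane would contain a third point.\<close>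

lemma minor_nonzero: "\<exists>i j. a $ i * b $ j - a $ j * b $ i \<noteq> 0"
proof (rule ccontr)
  assume "\<not> ?thesis"
  then have D: "a $ i * b $ j = a $ j * b $ i" for i j by simp
  obtain i where i: "a $ i \<noteq> 0" using a0 by (auto simp: vec_eq_iff)
  have l21: "eval_poly l2 x = b $ i / a $ i * eval_poly l1 x" for x
  proof -
    have "b $ j = b $ i / a $ i * a $ j" for j using D[of i j] i by (simp add: field_simps)
    then show ?thesis unfolding l1_eq l2_eq sum_distrib_left by (intro sum.cong refl) (metis mult.assoc)
  qed
  \<comment> \<open>Dimension count: if the kernel of \<open>l1\<close> lay in the span of
    \<open>p1\<close> and \<open>p2\<close>, adding \<open>axis i 1\<close> would give three
    generators of a 4-dimensional space.\<close>
  have "\<exists>z. eval_poly l1 z = 0 \<and> z \<notin> vec.span {p1, p2}"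
  proof (rule ccontr)
    assume "\<not> ?thesis"
    then have ker: "z \<in> vec.span {p1, p2}" if "eval_poly l1 z = 0" for z using that by blast
    have "x \<in> vec.span {axis i 1, p1, p2}" for x
    proof -
      define c where "c = eval_poly l1 x / a $ i"
      have "eval_poly l1 (x + (- c) *s axis i 1) = 0"
        unfolding l1_add l1_scale using i by (simp add: l1_eq[of "axis i 1"] sum_axis c_def)
      then have "x + (- c) *s axis i 1 \<in> vec.span {axis i 1, p1, p2}"
        using ker vec.span_mono[of "{p1, p2}" "{axis i 1, p1, p2}"] by blast
      moreover have "c *s axis i 1 \<in> vec.span {axis i 1, p1, p2}"
        by (rule vec.span_scale, rule vec.span_base) simp
      ultimately have "(x + (- c) *s axis i 1) + c *s axis i 1 \<in> vec.span {axis i 1, p1, p2}"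
        by (rule vec.span_add)
      then show ?thesis by (simp add: vec.scale_minus_left)
    qed
    then have "vec.dim (UNIV :: (complex ^ 4) set) \<le> card {axis i 1, p1, p2}"
      by (intro vec.dim_le_card) auto
    then have "4 \<le> card {axis i 1, p1, p2}"
      unfolding vec_dim_card by simp
    moreover have "card {axis i 1, p1, p2} \<le> 3"
      by (simp add: card_insert_if)
    ultimately show False by simp
  qed
  then obtain z where z: "eval_poly l1 z = 0" "z \<notin> vec.span {p1, p2}" by blast
  have z': "x *s p1 + y *s p2 + z \<noteq> w" if "w \<in> vec.span {p1, p2}" for x y w
  proof
    assume eq: "x *s p1 + y *s p2 + z = w"
    have "z = w - (x *s p1 + y *s p2)" unfolding eq[symmetric] by simp
    also have "\<dots> \<in> vec.span {p1, p2}"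
      by (intro vec.span_diff that vec.span_add; rule vec.span_scale, rule vec.span_base) simp_all
    finally show False using z by simp
  qed
  have B12: "B p1 p2 \<noteq> 0" by (rule isotropic_pair[OF p(3,5,7,4,6,8,1,2) p_neq])
  \<comment> \<open>On \<open>s *s p1 + t *s p2 + z\<close> the quadric is affine in
    \<open>s\<close> with coefficient \<open>t * B p1 p2 + B p1 z\<close>. The choice of
    \<open>t\<close> makes this coefficient 1, and \<open>s\<close> then solves the equation; as
    \<open>z\<close> is outside the span, the solution is a third point.\<close>
  define t where "t = (1 - B p1 z) / B p1 p2"
  define s where "s = - (t * B p2 z) - eval_poly q z"
  define x where "x = s *s p1 + t *s p2 + z"
  have "t * B p1 p2 + B p1 z = 1" using B12 by (simp add: t_def)
  moreover have "eval_poly q x = s * (t * B p1 p2 + B p1 z) + t * B p2 z + eval_poly q z"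
    using p by (simp add: x_def bilin B_sym[of z] algebra_simps)
  ultimately have "eval_poly q x = 0" by (simp add: s_def)
  moreover have "eval_poly l1 x = 0" using p z by (simp add: x_def bilin)
  moreover from this have "eval_poly l2 x = 0" by (simp add: l21)
  moreover have "x \<noteq> 0" unfolding x_def by (rule z') (rule vec.span_zero)
  ultimately obtain c where "x = c *s p1 \<or> x = c *s p2" using p_only by blast
  moreover have "c *s p1 \<in> vec.span {p1, p2}" "c *s p2 \<in> vec.span {p1, p2}"
    by (rule vec.span_scale, rule vec.span_base, simp)+
  ultimately show False using z' unfolding x_def by blast
qed


text \<open>Cramer's rule for the coordinates \<open>i\<close>, \<open>j\<close>, whose minor is
  nonzero. The other two coordinates \<open>k\<close>, \<open>m\<close> parametrize the common line
  of the planes, which \<open>w1\<close> and \<open>w2\<close> span; \<open>f0\<close> and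
  \<open>f1\<close> vanish there and are dual to \<open>l1\<close> and \<open>l2\<close>.\<close>

lemma coordinate_frame:
  obtains f0 f1 w1 w2 where
    "\<And>i. f0 $ i \<in> K" "\<And>i. f1 $ i \<in> K" "\<And>i. w1 $ i \<in> K" "\<And>i. w2 $ i \<in> K"
    "eval_poly l1 f0 = 1" "eval_poly l1 f1 = 0" "eval_poly l1 w1 = 0" "eval_poly l1 w2 = 0"
    "eval_poly l2 f0 = 0" "eval_poly l2 f1 = 1" "eval_poly l2 w1 = 0" "eval_poly l2 w2 = 0"
    "\<And>x. \<exists>s t. x = eval_poly l1 x *s f0 + eval_poly l2 x *s f1 + s *s w1 + t *s w2"
    "\<And>s t. s *s w1 + t *s w2 = 0 \<Longrightarrow> s = 0 \<and> t = 0"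
proof -
  obtain i j where D: "a $ i * b $ j - a $ j * b $ i \<noteq> 0" using minor_nonzero by blast
  then have "i \<noteq> j" by auto
  then have "card (UNIV - {i, j}) = 2" by (simp add: card_Diff_subset)
  then obtain k m where km: "UNIV - {i, j} = {k, m}" "k \<noteq> m" by (auto simp: card_2_iff)
  then have neq: "i \<noteq> j" "i \<noteq> k" "i \<noteq> m" "j \<noteq> k" "j \<noteq> m" "k \<noteq> m"
    using \<open>i \<noteq> j\<close> by auto
  have U: "(UNIV :: 4 set) = {i, j, k, m}" using km by auto
  have sumU: "(\<Sum>n\<in>UNIV. g n) = g i + g j + g k + g m" for g :: "4 \<Rightarrow> complex"
    unfolding U using neq by simp
  have allU: "(\<forall>n. P n) \<longleftrightarrow> P i \<and> P j \<and> P k \<and> P m" for P :: "4 \<Rightarrow> bool"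
    using U by (metis UNIV_I insertE singletonD)
  define d where "d = a $ i * b $ j - a $ j * b $ i"
  have d: "d \<noteq> 0" "d \<in> K" using D aK bK by (simp_all add: d_def)
  define vec4 where "vec4 x y z w = (\<chi> n. if n = i then x else if n = j then y else if n = k then z else w)"
    for x y z w :: complex
  have vec4 [simp]: "vec4 x y z w $ i = x" "vec4 x y z w $ j = y" "vec4 x y z w $ k = z" "vec4 x y z w $ m = w"
    for x y z w using neq by (auto simp: vec4_def)
  have vec4_K: "vec4 x y z w $ n \<in> K" if "x \<in> K" "y \<in> K" "z \<in> K" "w \<in> K" for x y z w n
    using that by (simp add: vec4_def)
  define f0 f1 where "f0 = vec4 (b $ j / d) (- b $ i / d) 0 0" and "f1 = vec4 (- a $ j / d) (a $ i / d) 0 0"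
  define w1 w2 where "w1 = vec4 ((a $ j * b $ k - a $ k * b $ j) / d) ((a $ k * b $ i - a $ i * b $ k) / d) 1 0"
    and "w2 = vec4 ((a $ j * b $ m - a $ m * b $ j) / d) ((a $ m * b $ i - a $ i * b $ m) / d) 0 1"
  note defs = f0_def f1_def w1_def w2_def
  have mem: "f0 $ n \<in> K" "f1 $ n \<in> K" "w1 $ n \<in> K" "w2 $ n \<in> K" for n
    unfolding defs using aK bK d by (auto intro!: vec4_K)
  have l1: "eval_poly l1 f0 = 1" "eval_poly l1 f1 = 0" "eval_poly l1 w1 = 0" "eval_poly l1 w2 = 0"
    unfolding l1_eq sumU defs using d by (simp_all add: field_simps) (simp_all add: d_def algebra_simps)
  have l2: "eval_poly l2 f0 = 0" "eval_poly l2 f1 = 1" "eval_poly l2 w1 = 0" "eval_poly l2 w2 = 0"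
    unfolding l2_eq sumU defs using d by (simp_all add: field_simps) (simp_all add: d_def algebra_simps)
  have "x = eval_poly l1 x *s f0 + eval_poly l2 x *s f1 + x $ k *s w1 + x $ m *s w2" for x
    unfolding vec_eq_iff allU l1_eq l2_eq sumU defs using d
    by (simp add: field_simps) (simp add: d_def algebra_simps)
  moreover have "s = 0 \<and> t = 0" if "s *s w1 + t *s w2 = 0" for s t
    using that unfolding vec_eq_iff allU defs by simp
  ultimately show ?thesis using mem l1 l2 by (intro that[of f0 f1 w1 w2]) blast+
qed

text \<open>A projective root is determined only up to a scalar, so \<open>s\<close> and
  \<open>t\<close> may be transcendental although their ratio is algebraic. Dividing by a nonzero
  one of them leaves 1 and that ratio, or 1 and 0.\<close>

lemma scale_root_into_number_field:
  assumes L: "number_field L" and abc: "A \<in> L" "C \<in> L" "D \<in> L" "A \<noteq> 0 \<or> C \<noteq> 0 \<or> D \<noteq> 0"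
    and st: "s \<noteq> 0 \<or> t \<noteq> 0" and root: "A * s\<^sup>2 + D * s * t + C * t\<^sup>2 = 0"
  shows "\<exists>M c. number_field M \<and> L \<subseteq> M \<and> c \<noteq> 0 \<and> c * s \<in> M \<and> c * t \<in> M"
proof (cases "t = 0")
  case True
  interpret L: num_field L by unfold_locales (rule L)
  show ?thesis
    using True st L by (intro exI[of _ L] exI[of _ "1 / s"]) simp
next
  case False
  have "A * (s / t)\<^sup>2 + D * (s / t) + C = 0"
    using root False by (simp add: field_simps power2_eq_square)
  then obtain M where M: "number_field M" "L \<subseteq> M" "s / t \<in> M"
    using number_field_adjoin_quadratic[OF L abc(1) abc(3) abc(2)] abc(4) by blast
  interpret M: num_field M by unfold_locales (rule M)
  show ?thesis
    using M False by (intro exI[of _ M] exI[of _ "1 / t"]) simp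
qed

text \<open>The vectors \<open>e1\<close>, \<open>e2\<close> are multiples of \<open>p1\<close>,
  \<open>p2\<close> with entries in \<open>L\<close>. Both are isotropic, so on their span
  \<open>q\<close> is just \<open>\<beta> * x2 * x3\<close>; making \<open>f0\<close> and
  \<open>f1\<close> orthogonal to them removes every other term containing \<open>x2\<close> or
  \<open>x3\<close>.\<close>

lemma adapted_frame:
  obtains L f0 f1 e1 e2 \<beta> where "number_field L" "K \<subseteq> L"
    "\<And>i. f0 $ i \<in> L" "\<And>i. f1 $ i \<in> L" "\<And>i. e1 $ i \<in> L" "\<And>i. e2 $ i \<in> L" "\<beta> \<in> L" "\<beta> \<noteq> 0"
    "\<And>x0 x1 x2 x3. eval_poly l1 (x0 *s f0 + x1 *s f1 + x2 *s e1 + x3 *s e2) = x0"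
    "\<And>x0 x1 x2 x3. eval_poly l2 (x0 *s f0 + x1 *s f1 + x2 *s e1 + x3 *s e2) = x1"
    "\<And>x0 x1 x2 x3. eval_poly q (x0 *s f0 + x1 *s f1 + x2 *s e1 + x3 *s e2) =
       eval_poly q (x0 *s f0 + x1 *s f1) + \<beta> * x2 * x3"
    "\<And>x. \<exists>x0 x1 x2 x3. x = x0 *s f0 + x1 *s f1 + x2 *s e1 + x3 *s e2"
proof -
  obtain g0 g1 w1 w2 where gK: "\<And>i. g0 $ i \<in> K" "\<And>i. g1 $ i \<in> K" "\<And>i. w1 $ i \<in> K" "\<And>i. w2 $ i \<in> K"
    and l1: "eval_poly l1 g0 = 1" "eval_poly l1 g1 = 0" "eval_poly l1 w1 = 0" "eval_poly l1 w2 = 0"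
    and l2: "eval_poly l2 g0 = 0" "eval_poly l2 g1 = 1" "eval_poly l2 w1 = 0" "eval_poly l2 w2 = 0"
    and span: "\<And>x. \<exists>s t. x = eval_poly l1 x *s g0 + eval_poly l2 x *s g1 + s *s w1 + t *s w2"
    and indep: "\<And>s t. s *s w1 + t *s w2 = 0 \<Longrightarrow> s = 0 \<and> t = 0"
    by (rule coordinate_frame) blast
  define A C D where "A = eval_poly q w1" and "C = eval_poly q w2" and "D = B w1 w2"
  have D_eq: "D = eval_poly q (w1 + w2) - A - C"
    unfolding A_def C_def D_def q_add by simp
  have ACD: "A \<in> K" "C \<in> K" "D \<in> K"
    unfolding D_eq unfolding A_def C_def
    using gK by (auto intro!: eval_form_mem[OF num_field_semiring_set[OF K] q] diff_mem)
  have q_line: "eval_poly q (s *s w1 + t *s w2) = A * s\<^sup>2 + D * s * t + C * t\<^sup>2" for s t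
    by (simp add: bilin A_def C_def D_def algebra_simps)
  \<comment> \<open>If \<open>q\<close> vanished on the common line of the planes, \<open>w1\<close>
    and \<open>w2\<close> would contradict \<open>isotropic_pair\<close>.\<close>
  have nz: "A \<noteq> 0 \<or> C \<noteq> 0 \<or> D \<noteq> 0"
  proof (rule ccontr)
    assume "\<not> ?thesis"
    then have "A = 0" "C = 0" "B w1 w2 = 0" by (auto simp: D_def)
    moreover have "w1 \<noteq> 0" "w2 \<noteq> 0" "\<And>c. w1 \<noteq> c *s w2" "\<And>c. w2 \<noteq> c *s w1"
      using indep[of 1 0] indep[of 0 1] indep[of 1 "- c" for c] indep[of "- c" 1 for c]
      by (auto simp: vec.scale_minus_left)
    ultimately show False using isotropic_pair[of w1 w2] l1 l2 unfolding A_def C_def by blast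
  qed
  have line: "\<exists>s t. x = s *s w1 + t *s w2" if "eval_poly l1 x = 0" "eval_poly l2 x = 0" for x
    using span[of x] that by simp
  obtain s1 t1 s2 t2 where p1: "p1 = s1 *s w1 + t1 *s w2" and p2: "p2 = s2 *s w1 + t2 *s w2"
    using line p by metis
  have st: "s1 \<noteq> 0 \<or> t1 \<noteq> 0" "s2 \<noteq> 0 \<or> t2 \<noteq> 0" using p(1,2) p1 p2 by auto
  obtain L1 c1 where L1: "number_field L1" "K \<subseteq> L1" "c1 \<noteq> 0" "c1 * s1 \<in> L1" "c1 * t1 \<in> L1"
    using scale_root_into_number_field[OF K ACD(1,2,3) nz st(1)] p(3) unfolding p1 q_line by blast
  have ACD1: "A \<in> L1" "C \<in> L1" "D \<in> L1" using ACD L1 by auto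
  \<comment> \<open>The second point is made rational over \<open>L1\<close>, so that
    \<open>L\<close> serves both.\<close>
  obtain L c2 where L: "number_field L" "L1 \<subseteq> L" "c2 \<noteq> 0" "c2 * s2 \<in> L" "c2 * t2 \<in> L"
    using scale_root_into_number_field[OF L1(1) ACD1(1,2,3) nz st(2)] p(4) unfolding p2 q_line by blast
  interpret L: num_field L by unfold_locales (rule L(1))
  have KL: "K \<subseteq> L" using L1 L by blast
  define e1 e2 where "e1 = c1 *s p1" and "e2 = c2 *s p2"
  have e_K: "e1 $ i \<in> L" "e2 $ i \<in> L" for i
  proof -
    have "e1 $ i = (c1 * s1) * w1 $ i + (c1 * t1) * w2 $ i" "e2 $ i = (c2 * s2) * w1 $ i + (c2 * t2) * w2 $ i"
      by (simp_all add: e1_def e2_def p1 p2 algebra_simps)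
    moreover have "c1 * s1 \<in> L" "c1 * t1 \<in> L" "w1 $ i \<in> L" "w2 $ i \<in> L" using L1 L KL gK by auto
    ultimately show "e1 $ i \<in> L" "e2 $ i \<in> L" using L(4,5) by (simp_all only: L.add_mem L.mult_mem)
  qed
  have e: "eval_poly q e1 = 0" "eval_poly q e2 = 0" "eval_poly l1 e1 = 0" "eval_poly l1 e2 = 0"
    "eval_poly l2 e1 = 0" "eval_poly l2 e2 = 0"
    using p by (simp_all add: e1_def e2_def bilin)
  define \<beta> where "\<beta> = B e1 e2"
  have \<beta>0: "\<beta> \<noteq> 0"
    using isotropic_pair[OF p(3,5,7,4,6,8,1,2) p_neq] L1(3) L(3) by (simp add: \<beta>_def e1_def e2_def bilin)
  have qL: "is_form L 2 q" using q KL by (rule is_form_mono)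
  have B_L: "B x y \<in> L" if "\<And>i. x $ i \<in> L" "\<And>i. y $ i \<in> L" for x y
  proof -
    have "B x y = eval_poly q (x + y) - eval_poly q x - eval_poly q y" by (simp add: q_add)
    also have "\<dots> \<in> L"
      using that by (intro L.diff_mem eval_form_mem[OF num_field_semiring_set[OF L(1)] qL]) simp_all
    finally show ?thesis .
  qed
  \<comment> \<open>Since \<open>e1\<close> is isotropic and pairs with \<open>e2\<close> to
    \<open>\<beta>\<close>, the multiple of \<open>e1\<close> cancels the pairing of
    \<open>g\<close> with \<open>e2\<close>, and the multiple of \<open>e2\<close> the pairing with
    \<open>e1\<close>.\<close>
  define r1 r2 where "r1 g = - B g e2 / \<beta>" and "r2 g = - B g e1 / \<beta>" for g
  define f0 f1 where "f0 = g0 + r1 g0 *s e1 + r2 g0 *s e2" and "f1 = g1 + r1 g1 *s e1 + r2 g1 *s e2"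
  have gL: "g0 $ i \<in> L" "g1 $ i \<in> L" for i using gK KL by auto
  have \<beta>L: "\<beta> \<in> L" unfolding \<beta>_def by (intro B_L e_K)
  have fL: "f0 $ i \<in> L" "f1 $ i \<in> L" for i
    unfolding f0_def f1_def r1_def r2_def using \<beta>L gL e_K by (simp_all add: B_L)
  have Bee: "B e1 e1 = 0" "B e2 e2 = 0" "B e2 e1 = \<beta>" "B e1 e2 = \<beta>"
    by (simp_all add: B_self e \<beta>_def B_sym[of e2 e1])
  have orth: "B f0 e1 = 0" "B f0 e2 = 0" "B f1 e1 = 0" "B f1 e2 = 0"
    using \<beta>0 unfolding f0_def f1_def bilin Bee by (simp_all add: r1_def r2_def)
  have l1f: "eval_poly l1 f0 = 1" "eval_poly l1 f1 = 0" "eval_poly l2 f0 = 0" "eval_poly l2 f1 = 1"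
    by (simp_all add: f0_def f1_def bilin e l1 l2)
  have span': "\<exists>x0 x1 x2 x3. x = x0 *s f0 + x1 *s f1 + x2 *s e1 + x3 *s e2" for x
  proof -
    define y where "y = x - (eval_poly l1 x *s f0 + eval_poly l2 x *s f1)"
    have xy: "x = y + (eval_poly l1 x *s f0 + eval_poly l2 x *s f1)" by (simp add: y_def)
    have "eval_poly l1 y = 0" "eval_poly l2 y = 0"
      using arg_cong[OF xy, of "eval_poly l1"] arg_cong[OF xy, of "eval_poly l2"] by (simp_all add: bilin l1f)
    then obtain s t where y: "y = s *s w1 + t *s w2" using line by blast
    \<comment> \<open>The determinant of \<open>p1\<close>, \<open>p2\<close> with respect to
      \<open>w1\<close>, \<open>w2\<close>. It is nonzero as the points differ, and Cramer's rule
      then expresses \<open>y\<close> through \<open>p1\<close> and \<open>p2\<close>.\<close>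
    define \<delta> where "\<delta> = s1 * t2 - s2 * t1"
    have \<delta>: "\<delta> \<noteq> 0"
    proof
      assume "\<delta> = 0"
      then have eq: "s1 * t2 = s2 * t1" by (simp add: \<delta>_def)
      show False
      proof (cases "s1 = 0")
        case True
        then have "s2 = 0" "t1 \<noteq> 0" using eq st(1) by auto
        then have "p2 = (t2 / t1) *s p1" using True by (simp add: p1 p2)
        then show False using p_neq by blast
      next
        case False
        then have "t2 = s2 / s1 * t1" using eq by (simp add: field_simps)
        then have "p2 = (s2 / s1) *s p1" using False by (simp add: p1 p2 vec.scale_right_distrib)
        then show False using p_neq by blast
      qed
    qed
    have "y = ((s * t2 - t * s2) / \<delta>) *s p1 + ((t * s1 - s * t1) / \<delta>) *s p2"
      using \<delta> by (simp add: y p1 p2 vec_eq_iff field_simps) (simp add: \<delta>_def algebra_simps)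
    then have "y = ((s * t2 - t * s2) / \<delta> / c1) *s e1 + ((t * s1 - s * t1) / \<delta> / c2) *s e2"
      using L1(3) L(3) by (simp add: e1_def e2_def)
    then have "x = eval_poly l1 x *s f0 + eval_poly l2 x *s f1 +
        ((s * t2 - t * s2) / \<delta> / c1) *s e1 + ((t * s1 - s * t1) / \<delta> / c2) *s e2"
      using xy by (simp add: add_ac)
    then show ?thesis by blast
  qed
  show ?thesis
  proof (rule that[OF L(1) KL fL(1) fL(2) e_K(1) e_K(2) \<beta>L \<beta>0 _ _ _ span'])
    fix x0 x1 x2 x3
    show "eval_poly l1 (x0 *s f0 + x1 *s f1 + x2 *s e1 + x3 *s e2) = x0"
      "eval_poly l2 (x0 *s f0 + x1 *s f1 + x2 *s e1 + x3 *s e2) = x1"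
      by (simp_all add: bilin l1f e)
    show "eval_poly q (x0 *s f0 + x1 *s f1 + x2 *s e1 + x3 *s e2) =
       eval_poly q (x0 *s f0 + x1 *s f1) + \<beta> * x2 * x3"
      by (simp add: bilin e orth Bee)
  qed
qed

end


section \<open>Integral points\<close>

context num_field
begin

text \<open>Equivalent absolute values are positive powers of each other, so the unit balls do not
  depend on the representative. The closed ball is reduced to the open one by taking
  inverses.\<close>

lemma valuation_ring_eq:
  assumes \<nu>: "\<nu> \<in> places K" and v: "v \<in> \<nu>"
  shows "valuation_ring K \<nu> = {x \<in> K. v x \<le> 1}" "valuation_ideal K \<nu> = {x \<in> K. v x < 1}"
proof -
  have lt: "w x < 1 \<longleftrightarrow> v x < 1" if "w \<in> \<nu>" "x \<in> K" for w x
    using equiv_less_1[OF place_equiv[OF \<nu> v that(1)] that(2)] .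
  have le: "w x \<le> 1 \<longleftrightarrow> v x \<le> 1" if w: "w \<in> \<nu>" and x: "x \<in> K" for w x
  proof (cases "x = 0")
    case False
    have pos: "\<not> v x \<le> 0" "\<not> w x \<le> 0" and av: "absval v" "absval w"
      using False x place_absval[OF \<nu> v] place_absval[OF \<nu> w] by (simp_all add: not_le)
    then have "1 < w x \<longleftrightarrow> 1 < v x"
      using lt[OF w, of "inverse x"] x unfolding av_inverse[OF av(1) x] av_inverse[OF av(2) x]
      by (simp add: inverse_less_1_iff pos del: av_pos)
    then show ?thesis by (auto simp flip: not_less)
  qed (use place_absval[OF \<nu> v] place_absval[OF \<nu> w] in simp)
  show "valuation_ring K \<nu> = {x \<in> K. v x \<le> 1}" "valuation_ideal K \<nu> = {x \<in> K. v x < 1}"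
    unfolding valuation_ring_def valuation_ideal_def using v lt le by blast+
qed

lemma semiring_set_ultrametric:
  assumes u: "ultrametric v"
  shows "semiring_set {x \<in> K. v x \<le> 1}"
  unfolding semiring_set_def using ultrametric_absval[OF u]
  by (auto simp: av_mult ultrametric_add_le[OF u] mult_le_one)

lemma finite_integral_places:
  assumes "finite E" "E \<subseteq> K"
  obtains S where "finite S" "S \<subseteq> places K" "{\<nu> \<in> places K. archimedean K \<nu>} \<subseteq> S"
    "\<And>\<nu> v x. \<nu> \<in> places K - S \<Longrightarrow> v \<in> \<nu> \<Longrightarrow> x \<in> E \<Longrightarrow> v x \<le> 1"
proof
  define T where "T x = {\<nu> \<in> places K. \<not> archimedean K \<nu> \<and> (\<exists>v\<in>\<nu>. v x > 1)}" for x
  define S where "S = {\<nu> \<in> places K. archimedean K \<nu>} \<union> (\<Union>x\<in>E. T x)"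
  show "finite S"
    using assms finite_archimedean_places finite_nonintegral_places unfolding S_def T_def by blast
  show "S \<subseteq> places K" "{\<nu> \<in> places K. archimedean K \<nu>} \<subseteq> S" by (auto simp: S_def T_def)
  show "v x \<le> 1" if "\<nu> \<in> places K - S" "v \<in> \<nu>" "x \<in> E" for \<nu> v x
    using that by (auto simp: S_def T_def not_le[symmetric])
qed

end

section \<open>Unit points and Zariski density\<close>

lemma infinite_powers_of_two: "infinite (range (\<lambda>n. 2 ^ n :: complex))"
proof (rule range_inj_infinite, rule injI)
  fix m n :: nat assume "(2 :: complex) ^ m = 2 ^ n"
  then have "of_nat (2 ^ m) = (of_nat (2 ^ n) :: complex)" by simp
  then show "m = n" by (simp only: of_nat_eq_iff power_inject_exp one_less_numeral_iff semiring_norm)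
qed

text \<open>For units \<open>u\<close>, \<open>t\<close>, \<open>w\<close> the value \<open>x\<^sub>3 = (w - N) / (\<beta> * t)\<close>, where \<open>N\<close> is the value of the
  quadric at \<open>f0 + u *s f1\<close>, solves \<open>N + \<beta> * t * x\<^sub>3 = w\<close>.\<close>

definition unit_point :: "'n::finite polynomial \<Rightarrow> complex ^ 'n \<Rightarrow> complex ^ 'n \<Rightarrow> complex ^ 'n \<Rightarrow> complex ^ 'n \<Rightarrow>
    complex \<Rightarrow> complex \<Rightarrow> complex \<Rightarrow> complex \<Rightarrow> complex ^ 'n" where
  "unit_point q f0 f1 e1 e2 \<beta> u t w =
     1 *s f0 + u *s f1 + t *s e1 + ((w - eval_poly q (1 *s f0 + u *s f1)) / (\<beta> * t)) *s e2"

text \<open>The coefficient of \<open>e2\<close> is freed first: for fixed \<open>u\<close> and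
  \<open>t\<close> it is an injective affine function of \<open>w\<close>, so it takes infinitely
  many values. Once it is arbitrary, the coefficients of \<open>e1\<close> and \<open>f1\<close> run
  through the powers of 2 independently of it and are freed in turn. Homogeneity reduces
  \<open>x0 \<noteq> 0\<close> to \<open>x0 = 1\<close>.\<close>

lemma vanish_of_vanish_on_unit_points:
  assumes "\<beta> \<noteq> 0" and f: "is_form R d f"
    and zero: "\<And>i j k. eval_poly f (unit_point q f0 f1 e1 e2 \<beta> (2 ^ i) (2 ^ j) (2 ^ k)) = 0"
    and "x0 \<noteq> 0"
  shows "eval_poly f (x0 *s f0 + x1 *s f1 + x2 *s e1 + x3 *s e2) = 0"
proof -
  let ?T = "range (\<lambda>n. 2 ^ n :: complex)"
  have 1: "eval_poly f ((f0 + u *s f1 + t *s e1) + z *s e2) = 0" if ut: "u \<in> ?T" "t \<in> ?T" for u t z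
  proof (rule eval_poly_zero_on_line)
    let ?g = "\<lambda>w. (w - eval_poly q (f0 + u *s f1)) / (\<beta> * t)"
    have "t \<noteq> 0" using ut by auto
    then have "inj ?g" using assms(1) by (auto simp: inj_on_def)
    then show "infinite (?g ` ?T)"
      using infinite_powers_of_two by (meson finite_imageD inj_on_subset subset_UNIV)
    show "eval_poly f ((f0 + u *s f1 + t *s e1) + z *s e2) = 0" if "z \<in> ?g ` ?T" for z
      using that ut zero by (auto simp: unit_point_def)
  qed
  have 2: "eval_poly f ((f0 + u *s f1 + z *s e2) + t *s e1) = 0" if u: "u \<in> ?T" for u t z
  proof (rule eval_poly_zero_on_line[OF infinite_powers_of_two])
    fix t assume t: "t \<in> ?T"
    have eq: "(f0 + u *s f1 + z *s e2) + t *s e1 = (f0 + u *s f1 + t *s e1) + z *s e2" by (simp add: add_ac)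
    show "eval_poly f ((f0 + u *s f1 + z *s e2) + t *s e1) = 0" unfolding eq by (rule 1[OF u t])
  qed
  have 3: "eval_poly f ((f0 + t *s e1 + z *s e2) + u *s f1) = 0" for u t z
  proof (rule eval_poly_zero_on_line[OF infinite_powers_of_two])
    fix u assume u: "u \<in> ?T"
    have eq: "(f0 + t *s e1 + z *s e2) + u *s f1 = (f0 + u *s f1 + z *s e2) + t *s e1" by (simp add: add_ac)
    show "eval_poly f ((f0 + t *s e1 + z *s e2) + u *s f1) = 0" unfolding eq by (rule 2[OF u])
  qed
  have "x0 *s f0 + x1 *s f1 + x2 *s e1 + x3 *s e2 =
      x0 *s ((f0 + (x2 / x0) *s e1 + (x3 / x0) *s e2) + (x1 / x0) *s f1)"
    using \<open>x0 \<noteq> 0\<close> by (simp add: vec.scale_right_distrib add_ac)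
  then show ?thesis by (simp only: eval_form_scale[OF f] 3 mult_zero_right)
qed

context num_field
begin

text \<open>Coordinates used for the reduction have the form \<open>c *s y\<close>, where
  \<open>f\<close> takes the value \<open>c ^ d\<close> times a unit. If this lies in the maximal
  ideal, so does \<open>c\<close>, and since \<open>y\<close> is integral all coordinates would
  reduce to zero, which is excluded.\<close>

lemma not_reduces_into:
  fixes y :: "complex ^ 'n::finite"
  assumes \<nu>: "\<nu> \<in> places K" "\<not> archimedean K \<nu>" and v: "v \<in> \<nu>"
    and f: "is_form {x \<in> K. v x \<le> 1} d f" "d > 0" and D: "D \<subseteq> zero_locus {f}"
    and y: "\<And>i. y $ i \<in> K" "\<And>i. v (y $ i) \<le> 1" and val: "v (eval_poly f y) = 1" "eval_poly f y \<in> K"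
  shows "\<not> reduces_into K \<nu> (proj_pt y) D"
proof
  note av = place_absval[OF \<nu>(1) v]
  note eqs = valuation_ring_eq[OF \<nu>(1) v]
  assume "reduces_into K \<nu> (proj_pt y) D"
  then obtain x where x: "x \<in> hcoords (proj_pt y)" "\<And>i. x $ i \<in> valuation_ring K \<nu>"
    "\<exists>i. x $ i \<notin> valuation_ideal K \<nu>"
    "\<And>d f. is_form (valuation_ring K \<nu>) d f \<Longrightarrow> D \<subseteq> zero_locus {f} \<Longrightarrow> eval_poly f x \<in> valuation_ideal K \<nu>"
    unfolding reduces_into_def by blast
  have y0: "y \<noteq> 0"
  proof
    assume "y = 0"
    then have "eval_poly f y = 0" using eval_form_scale[OF f(1), of 0 y] f(2) by (simp add: zero_power)
    then show False using val av by simp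
  qed
  obtain c where c: "c \<noteq> 0" "x = c *s y" using x(1) hcoords_proj_pt[OF y0] by blast
  obtain i where i: "y $ i \<noteq> 0" using y0 by (auto simp: vec_eq_iff)
  have "c = x $ i / y $ i" using c i by simp
  then have cK: "c \<in> K" using x(2)[of i] y eqs by simp
  have "v (eval_poly f x) < 1" using x(4)[of d f] f D unfolding eqs by blast
  then have "v c ^ d < 1"
    using val cK av by (simp add: c eval_form_scale[OF f(1)] av_mult av_power)
  then have vc: "v c < 1" using one_le_power[of "v c" d] by fastforce
  have "x $ j \<in> valuation_ideal K \<nu>" for j
  proof -
    have "v c * v (y $ j) \<le> v c * 1" using y cK av by (intro mult_left_mono) auto
    then have "v c * v (y $ j) < 1" using vc by linarith
    then have "v (x $ j) < 1" using y cK av by (simp add: c av_mult)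
    then show ?thesis using y cK by (simp add: eqs c)
  qed
  then show False using x(3) by blast
qed

end

section \<open>Density of the integral points on the complement\<close>

theorem mainTheorem2:
  fixes K :: "complex set" and Q \<Pi>1 \<Pi>2 :: "4 proj set"
  assumes "number_field K"
    and "smooth_quadric K Q"
    and "hyperplane K \<Pi>1"
    and "hyperplane K \<Pi>2"
    and "card (Q \<inter> \<Pi>1 \<inter> \<Pi>2) = 2"
  shows "potentially_dense K UNIV (Q \<union> \<Pi>1 \<union> \<Pi>2)"
proof -
  interpret K: num_field K by unfold_locales (rule assms(1))
  obtain q where qform: "is_form K 2 q" "Q = zero_locus {q}"
    using assms(2) unfolding smooth_quadric_def by blast
  obtain l1 where l1: "l1 \<noteq> 0" "is_form K 1 l1" "\<Pi>1 = zero_locus {l1}"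
    using assms(3) unfolding hyperplane_def by blast
  obtain l2 where l2: "l2 \<noteq> 0" "is_form K 1 l2" "\<Pi>2 = zero_locus {l2}"
    using assms(4) unfolding hyperplane_def by blast
  obtain a where a: "\<And>i. a $ i \<in> K" "a \<noteq> 0" "\<And>x. eval_poly l1 x = (\<Sum>i\<in>UNIV. a $ i * x $ i)"
    by (rule linear_form_coeffs[OF l1(2,1) K.zero_mem]) blast
  obtain b where b: "\<And>i. b $ i \<in> K" "b \<noteq> 0" "\<And>x. eval_poly l2 x = (\<Sum>i\<in>UNIV. b $ i * x $ i)"
    by (rule linear_form_coeffs[OF l2(2,1) K.zero_mem]) blast
  obtain B where B: "\<And>x y. eval_poly q (x + y) = eval_poly q x + eval_poly q y + B x y"
    "\<And>x y z. B (x + y) z = B x z + B y z" "\<And>c x y. B (c *s x) y = c * B x y" "\<And>x y. B x y = B y x"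
    by (rule quadratic_form_polarization[OF qform(1)]) blast
  have mem: "proj_pt x \<in> Q \<longleftrightarrow> eval_poly q x = 0" "proj_pt x \<in> \<Pi>1 \<longleftrightarrow> eval_poly l1 x = 0"
    "proj_pt x \<in> \<Pi>2 \<longleftrightarrow> eval_poly l2 x = 0" if "x \<noteq> 0" for x
    using that qform l1 l2 by (simp_all add: proj_pt_in_zero_locus[OF qform(1)]
        proj_pt_in_zero_locus[OF l1(2)] proj_pt_in_zero_locus[OF l2(2)])
  obtain P1 P2 where P: "Q \<inter> \<Pi>1 \<inter> \<Pi>2 = {P1, P2}" "P1 \<noteq> P2"
    using assms(5) by (auto simp: card_2_iff)
  obtain p1 where p1: "p1 \<noteq> 0" "P1 = proj_pt p1" by (rule proj_pt_cases)
  obtain p2 where p2: "p2 \<noteq> 0" "P2 = proj_pt p2" by (rule proj_pt_cases)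
  have on: "P1 \<in> Q" "P1 \<in> \<Pi>1" "P1 \<in> \<Pi>2" "P2 \<in> Q" "P2 \<in> \<Pi>1" "P2 \<in> \<Pi>2" using P(1) by blast+
  interpret plane_pair K l1 l2 q a b B p1 p2
  proof unfold_locales
    show "p1 \<noteq> c *s p2" "p2 \<noteq> c *s p1" for c
      using P(2) proj_pt_scale[of c p1] proj_pt_scale[of c p2] p1 p2 by auto
    show "\<exists>c. c \<noteq> 0 \<and> (x = c *s p1 \<or> x = c *s p2)"
      if "x \<noteq> 0" "eval_poly q x = 0" "eval_poly l1 x = 0" "eval_poly l2 x = 0" for x
    proof -
      have "proj_pt x \<in> Q \<inter> \<Pi>1 \<inter> \<Pi>2" using that mem by simp
      then have "proj_pt x = proj_pt p1 \<or> proj_pt x = proj_pt p2" using P(1) p1 p2 by simp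
      then show ?thesis using proj_pt_eqD[OF that(1)] p1 p2 by blast
    qed
  qed (use assms(1) qform a b B p1 p2 on mem[of p1] mem[of p2] in simp_all)
  obtain L f0 f1 e1 e2 \<beta> where L: "number_field L" "K \<subseteq> L"
    and vecs: "\<And>i. f0 $ i \<in> L" "\<And>i. f1 $ i \<in> L" "\<And>i. e1 $ i \<in> L" "\<And>i. e2 $ i \<in> L"
    and \<beta>: "\<beta> \<in> L" "\<beta> \<noteq> 0"
    and l1_fr: "\<And>x0 x1 x2 x3. eval_poly l1 (x0 *s f0 + x1 *s f1 + x2 *s e1 + x3 *s e2) = x0"
    and l2_fr: "\<And>x0 x1 x2 x3. eval_poly l2 (x0 *s f0 + x1 *s f1 + x2 *s e1 + x3 *s e2) = x1"
    and q_fr: "\<And>x0 x1 x2 x3. eval_poly q (x0 *s f0 + x1 *s f1 + x2 *s e1 + x3 *s e2) =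
       eval_poly q (x0 *s f0 + x1 *s f1) + \<beta> * x2 * x3"
    and frame: "\<And>x. \<exists>x0 x1 x2 x3. x = x0 *s f0 + x1 *s f1 + x2 *s e1 + x3 *s e2"
    by (rule adapted_frame) blast
  interpret L: num_field L by unfold_locales (rule L(1))
  define coeffs where "coeffs f = Poly_Mapping.lookup f ` Poly_Mapping.keys f" for f :: "4 polynomial"
  \<comment> \<open>Besides the frame and the coefficients of the forms,
    \<open>inverse \<beta>\<close> is needed for the division in \<open>unit_point\<close>, and
    \<open>inverse 2\<close> turns the powers of 2 into units outside \<open>S\<close>.\<close>
  define E where "E = range (($) f0) \<union> range (($) f1) \<union> range (($) e1) \<union> range (($) e2) \<union>
    {inverse \<beta>, inverse 2} \<union> coeffs l1 \<union> coeffs l2 \<union> coeffs q"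
  have "finite E" by (simp add: E_def coeffs_def)
  moreover have "coeffs l1 \<subseteq> L" "coeffs l2 \<subseteq> L" "coeffs q \<subseteq> L"
    using l1(2) l2(2) qform(1) L(2) by (auto simp: coeffs_def is_form_def)
  then have EL: "E \<subseteq> L" using vecs \<beta> by (auto simp: E_def)
  ultimately obtain S where S: "finite S" "S \<subseteq> places L" "{\<nu> \<in> places L. archimedean L \<nu>} \<subseteq> S"
    and int: "\<And>\<nu> v x. \<nu> \<in> places L - S \<Longrightarrow> v \<in> \<nu> \<Longrightarrow> x \<in> E \<Longrightarrow> v x \<le> 1"
    by (rule L.finite_integral_places) blast
  define pt where "pt i j k = unit_point q f0 f1 e1 e2 \<beta> (2 ^ i) (2 ^ j) (2 ^ k)" for i j k :: nat
  let ?D = "Q \<union> \<Pi>1 \<union> \<Pi>2"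
  have vals: "eval_poly l1 (pt i j k) = 1" "eval_poly l2 (pt i j k) = 2 ^ i" "eval_poly q (pt i j k) = 2 ^ k" for i j k
    unfolding pt_def unit_point_def l1_fr l2_fr q_fr using \<beta> by simp_all
  have pt0: "pt i j k \<noteq> 0" for i j k
    using vals(1)[of i j k] a(3)[of 0] by auto
  have qL: "is_form L 2 q" using qform(1) L(2) by (rule is_form_mono)
  \<comment> \<open>Stated for a general \<open>R\<close> because it is applied twice: with
    \<open>R = L\<close> for rationality and with \<open>R\<close> a valuation ring for integrality.
    The element \<open>- 1\<close> serves to subtract the value of the quadric.\<close>
  have pt_mem: "pt i j k $ n \<in> R"
    if R: "semiring_set R" and "E \<subseteq> R" "- 1 \<in> R" and qR: "is_form R 2 q" for R i j k n
  proof -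
    have fr: "f0 $ n \<in> R" "f1 $ n \<in> R" "e1 $ n \<in> R" "e2 $ n \<in> R" "inverse \<beta> \<in> R" "inverse 2 \<in> R" for n
      using that by (auto simp: E_def)
    have two: "2 \<in> R" using R unfolding semiring_set_def by (metis one_add_one)
    note R_intros = semiring_set_add[OF R] semiring_set_mult[OF R] semiring_set_power[OF R]
    define N where "N = eval_poly q (1 *s f0 + 2 ^ i *s f1)"
    have "N \<in> R"
      unfolding N_def using fr two by (intro eval_form_mem[OF R qR]) (simp add: R_intros)
    moreover have "inverse (2 ^ j) \<in> R"
      using semiring_set_power[OF R fr(6), of j] by (simp only: power_inverse)
    ultimately have "f0 $ n + 2 ^ i * f1 $ n + 2 ^ j * e1 $ n +
        ((2 ^ k + (- 1) * N) * (inverse \<beta> * inverse (2 ^ j))) * e2 $ n \<in> R"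
      using fr two that(3) by (intro R_intros) auto
    moreover have "pt i j k $ n = f0 $ n + 2 ^ i * f1 $ n + 2 ^ j * e1 $ n +
        ((2 ^ k + (- 1) * N) * (inverse \<beta> * inverse (2 ^ j))) * e2 $ n"
    proof -
      have "(2 ^ k - N) / (\<beta> * 2 ^ j) = (2 ^ k + (- 1) * N) * (inverse \<beta> * inverse (2 ^ j))"
        by (simp only: divide_inverse inverse_mult_distrib mult_minus1 diff_conv_add_uminus)
      then show ?thesis
        unfolding pt_def unit_point_def N_def[symmetric] by (simp only: vector_add_component
            vector_smult_component mult_1_left)
    qed
    ultimately show ?thesis by simp
  qed
  have integral: "proj_pt (pt i j k) \<in> integral_points L S UNIV ?D" for i j k
    unfolding integral_points_def
  proof (intro CollectI conjI IntI DiffI ballI UNIV_I)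
    have ptL: "pt i j k $ n \<in> L" for n
      by (rule pt_mem[OF num_field_semiring_set[OF L(1)] EL _ qL]) simp
    have "pt i j k \<in> hcoords (proj_pt (pt i j k))"
      unfolding hcoords_proj_pt[OF pt0] by (auto intro!: exI[of _ 1])
    then show "proj_pt (pt i j k) \<in> rational_points L"
      using ptL unfolding rational_points_def by blast
    show "proj_pt (pt i j k) \<notin> ?D"
      using mem[OF pt0] by (simp add: vals)
    fix \<nu> assume \<nu>: "\<nu> \<in> places L - S"
    then have na: "\<nu> \<in> places L" "\<not> archimedean L \<nu>" using S(3) by auto
    obtain v where v: "v \<in> \<nu>" using L.place_nonempty[OF na(1)] by blast
    have u: "L.ultrametric v" by (rule L.ultrametric_place[OF na v])
    note av = L.ultrametric_absval[OF u]
    define R where "R = {x \<in> L. v x \<le> 1}"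
    have R: "semiring_set R" unfolding R_def by (rule L.semiring_set_ultrametric[OF u])
    have ER: "E \<subseteq> R" using EL int[OF \<nu> v] by (auto simp: R_def)
    have "coeffs l1 \<subseteq> R" "coeffs l2 \<subseteq> R" "coeffs q \<subseteq> R" using ER by (auto simp: E_def)
    then have forms: "is_form R 1 l1" "is_form R 1 l2" "is_form R 2 q"
      using l1(2) l2(2) qform(1) by (auto simp: coeffs_def is_form_def)
    \<comment> \<open>The product vanishes on all of \<open>?D\<close>, and its value at the point
      is \<open>2 ^ i * 2 ^ k\<close>, a unit outside \<open>S\<close>.\<close>
    let ?f = "l1 * l2 * q"
    have f: "is_form R (1 + 1 + 2) ?f" by (intro is_form_mult R forms)
    have ptR: "pt i j k $ n \<in> R" for n
      by (rule pt_mem[OF R ER _ forms(3)]) (use av in \<open>simp add: R_def\<close>)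
    have "v 2 = 1"
    proof -
      have "v 2 \<le> 1" using L.ultrametric_of_nat[OF u, of 2] by simp
      moreover have "inverse (v 2) \<le> 1"
        using int[OF \<nu> v, of "inverse 2"] unfolding L.av_inverse[OF av L.numeral_mem] by (simp add: E_def)
      moreover have "v 2 > 0" using av by simp
      ultimately show ?thesis by (simp add: field_simps)
    qed
    then have val: "v (eval_poly ?f (pt i j k)) = 1"
      using av by (simp add: eval_poly_mult vals L.av_mult L.av_power)
    show "\<not> reduces_into L \<nu> (proj_pt (pt i j k)) ?D"
    proof (rule L.not_reduces_into[OF na v f[unfolded R_def] _ _ _ _ val])
      show "?D \<subseteq> zero_locus {?f}"
        unfolding qform(2) l1(3) l2(3) zero_locus_def by (auto simp: eval_poly_mult)
      show "eval_poly ?f (pt i j k) \<in> L" by (simp add: eval_poly_mult vals)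
    qed (use ptR in \<open>auto simp: R_def\<close>)
  qed
  have "zariski_dense_in (integral_points L S UNIV ?D) (UNIV - ?D)"
    unfolding zariski_dense_in_def
  proof (intro conjI allI impI subsetI)
    fix P assume "P \<in> integral_points L S UNIV ?D"
    then show "P \<in> UNIV - ?D" by (simp add: integral_points_def)
  next
    fix Z P assume Z: "zariski_closed Z \<and> integral_points L S UNIV ?D \<subseteq> Z" and P: "P \<in> UNIV - ?D"
    obtain F where F: "\<And>f. f \<in> F \<Longrightarrow> \<exists>d. is_form UNIV d f" "Z = zero_locus F"
      using Z unfolding zariski_closed_def by blast
    obtain x where x: "x \<noteq> 0" "P = proj_pt x" by (rule proj_pt_cases)
    obtain x0 x1 x2 x3 where fr: "x = x0 *s f0 + x1 *s f1 + x2 *s e1 + x3 *s e2" using frame by blast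
    \<comment> \<open>The first coordinate of \<open>x\<close> in the frame is the value of
      \<open>l1\<close>; it is nonzero off the first plane, so it can be scaled to 1.\<close>
    have "eval_poly l1 x \<noteq> 0" using P x mem(2)[OF x(1)] by simp
    then have x0: "x0 \<noteq> 0" unfolding fr l1_fr .
    have "proj_pt x \<in> zero_locus {f}" if f: "f \<in> F" for f
    proof -
      obtain d where d: "is_form UNIV d f" using F f by blast
      have "eval_poly f (pt i j k) = 0" for i j k
      proof -
        have "proj_pt (pt i j k) \<in> zero_locus {f}"
          using integral[of i j k] Z F(2) f by (auto simp: zero_locus_def)
        then show ?thesis using proj_pt_in_zero_locus[OF d pt0] by simp
      qed
      then have "eval_poly f x = 0"
        unfolding fr pt_def by (intro vanish_of_vanish_on_unit_points[OF \<beta>(2) d _ x0])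
      then show ?thesis using proj_pt_in_zero_locus[OF d x(1)] by simp
    qed
    then show "P \<in> Z" unfolding F(2) x(2) zero_locus_def by blast
  qed
  then show ?thesis
    unfolding potentially_dense_def using L S by blast
qed

end
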